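(* There is a universal constant $C\in(0,\infty)$ such that, for every $p\in[2,\infty)$, $n\in\mathbb N$, $k\in[n]$, $\mathbb K\in\{\mathbb R,\mathbb C\}$, and every $h:\Omega_n\to\mathbb K$ with $\mathbb E h=0$, $$\left(\binom nk^{-1}\sum_{\substack{S\subseteq[n]\\|S|=k}}\|P_Sh\|_{L_p(\Omega_n)}^p\right)^{1/p}\le C\,\frac{p}{\log p}\left[\frac kn\sum_{j=1}^n\|\partial_jh\|_{L_p(\Omega_n)}^p+\left(\frac kn\right)^{p/2}\|h\|_{L_p(\Omega_n)}^p\right]^{1/p}.$$ Moreover, the order $p/\log p$ is optimal up to universal multiplicative constants: there is a universal constant $c>0$ such that, for every $p\in[2,\infty)$, if $K\in[0,\infty)$ is such that $$\left(\binom nk^{-1}\sum_{\substack{S\subseteq[n]\\|S|=k}}\|P_Sh\|_{L_p(\Omega_n)}^p\right)^{1/p}\le K\left[\frac kn\sum_{j=1}^n\|\partial_jh\|_{L_p(\Omega_n)}^p+\left(\frac kn\right)^{p/2}\|h\|_{L_p(\Omega_n)}^p\right]^{1/p}$$ for all $n\in\mathbb N$, $k\in[n]$, $\mathbb K\in\{\mathbb R,\mathbb C\}$ and all mean-zero $h:\Omega_n\to\mathbb K$, then $K\ge c\,p/\log p$.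
   Context: $[n]=\{1,\dots,n\}$, $\Omega_n=\{-1,1\}^n$ with the uniform probability measure; $\mathbb E h$ is the average of $h$ over $\Omega_n$ and $\|h\|_{L_p(\Omega_n)}=(\mathbb E|h|^p)^{1/p}$. For $S\subseteq[n]$, $P_Sh$ denotes the conditional expectation obtained by averaging over the coordinates outside $S$: $P_Sh(\varepsilon)$ is the average of $h(\eta)$ over all $\eta\in\Omega_n$ with $\eta_j=\varepsilon_j$ for every $j\in S$. If $\varepsilon^{(j)}$ is obtained from $\varepsilon$ by changing the sign of the $j$th coordinate, then $\partial_jh(\varepsilon)=h(\varepsilon)-h(\varepsilon^{(j)})$. Logarithms are natural. "Universal constant" means an absolute constant independent of all parameters. *)

theory Defs
  imports "HOL-Analysis.Analysis"
begin

text \<open>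
  A function on the cube is a total function on \<^typ>\<open>nat \<Rightarrow> real\<close>; every notion below depends only on
  its values on \<open>cube n\<close>, so values elsewhere are irrelevant. Points of the cube are extensional
  (\<^const>\<open>undefined\<close> outside \<open>{1..n}\<close>), so that \<open>cube n\<close> has exactly \<open>2 ^ n\<close> elements.
\<close>

definition cube :: "nat \<Rightarrow> (nat \<Rightarrow> real) set" where
  "cube n = (\<Pi>\<^sub>E j\<in>{1..n}. {-1, 1})"

definition average :: "'b set \<Rightarrow> ('b \<Rightarrow> 'a::real_normed_vector) \<Rightarrow> 'a" where
  "average A f = (\<Sum>x\<in>A. f x) /\<^sub>R real (card A)"

definition cube_expectation :: "nat \<Rightarrow> ((nat \<Rightarrow> real) \<Rightarrow> 'a::real_normed_vector) \<Rightarrow> 'a" where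
  "cube_expectation n h = average (cube n) h"

definition cube_Lp_norm :: "nat \<Rightarrow> real \<Rightarrow> ((nat \<Rightarrow> real) \<Rightarrow> 'a::real_normed_vector) \<Rightarrow> real" where
  "cube_Lp_norm n p h = cube_expectation n (\<lambda>\<epsilon>. norm (h \<epsilon>) powr p) powr (1 / p)"

definition cube_proj ::
    "nat \<Rightarrow> nat set \<Rightarrow> ((nat \<Rightarrow> real) \<Rightarrow> 'a::real_normed_vector) \<Rightarrow> (nat \<Rightarrow> real) \<Rightarrow> 'a" where
  "cube_proj n S h \<epsilon> = average {\<eta> \<in> cube n. \<forall>j\<in>S. \<eta> j = \<epsilon> j} h"

definition cube_deriv ::
    "nat \<Rightarrow> ((nat \<Rightarrow> real) \<Rightarrow> 'a::real_normed_vector) \<Rightarrow> (nat \<Rightarrow> real) \<Rightarrow> 'a" where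
  "cube_deriv j h \<epsilon> = h \<epsilon> - h (\<epsilon>(j := - \<epsilon> j))"

definition proj_moment ::
    "nat \<Rightarrow> nat \<Rightarrow> real \<Rightarrow> ((nat \<Rightarrow> real) \<Rightarrow> 'a::real_normed_vector) \<Rightarrow> real" where
  "proj_moment n k p h =
     ((\<Sum>S | S \<subseteq> {1..n} \<and> card S = k. cube_Lp_norm n p (cube_proj n S h) powr p)
        / real (n choose k)) powr (1 / p)"

definition deriv_moment ::
    "nat \<Rightarrow> nat \<Rightarrow> real \<Rightarrow> ((nat \<Rightarrow> real) \<Rightarrow> 'a::real_normed_vector) \<Rightarrow> real" where
  "deriv_moment n k p h =
     (real k / real n * (\<Sum>j=1..n. cube_Lp_norm n p (cube_deriv j h) powr p)
        + (real k / real n) powr (p / 2) * cube_Lp_norm n p h powr p) powr (1 / p)"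

end

theory Submission
  imports Defs
begin

text \<open>
  Write \<open>P\<^sub>S\<close> for the projection onto the coordinates in \<open>S\<close>. The upper bound follows by revealing the
  elements of a uniformly random set \<open>S\<close> one at a time. Adding a coordinate \<open>j\<close> turns \<open>P\<^sub>S h\<close> into
  \<open>P\<^sub>S h + \<epsilon> j *\<^sub>R c\<^sub>j\<close>, where \<open>c\<^sub>j\<close> depends only on the coordinates in \<open>S\<close> (lemma \<open>cube_proj_insert\<close>); so, for
  fixed \<open>S\<close> and fixed coordinates in \<open>S\<close>, the step is a symmetric jump. For symmetric jumps in an
  inner product space, with average taken over the two signs,
    \<open>average (norm (x \<plusminus> c) powr p) \<le> norm x powr p + p powr (5 / 2) * norm x powr (p - 2) * (norm c)\<^sup>2
       + (4 * (p / ln p)) powr p * norm c powr p\<close>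
  (lemma \<open>symmetrized_norm_powr_le\<close>). Summing over \<open>j\<close> outside \<open>S\<close>, the squares of the \<open>c\<^sub>j\<close> are controlled by
  Bessel's inequality, \<open>(\<Sum>j. (norm c\<^sub>j)\<^sup>2) \<le> P\<^sub>S (norm h)\<^sup>2\<close>, because the \<open>c\<^sub>j\<close> are Walsh coefficients of order
  one of \<open>h\<close> in the coordinates outside \<open>S\<close> (lemma \<open>sum_norm_increment_square_le\<close>), and their \<open>p\<close>-th powers
  by Jensen's inequality, because \<open>c\<^sub>j\<close> is also a projection of half the \<open>j\<close>-th derivative up to sign.

  Let \<open>u i\<close> be the average of \<open>\<parallel>P\<^sub>S h\<parallel>\<^sub>p\<^sup>p\<close> over the sets of size \<open>i\<close>. With Hoelder's inequality for
  the mixed term, and as long as at most half of the coordinates are revealed,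
    \<open>u (Suc i) \<le> u i + p powr (5 / 2) * (2 / n) * \<parallel>h\<parallel>\<^sub>p\<^sup>2 * u i powr (1 - 2 / p)
       + (2 * (p / ln p)) powr p * (1 / n) * (\<Sum>j. \<parallel>\<partial>\<^sub>j h\<parallel>\<^sub>p\<^sup>p)\<close>,
  and \<open>u 0 = 0\<close> as \<open>h\<close> has mean zero. Solving this recursion (lemma \<open>subset_average_proj_energy_le\<close>)
  gives the constant \<open>p / ln p\<close> in front of the derivatives, and \<open>p powr (3 / 4)\<close>, which is smaller up to
  a universal factor, in front of \<open>(k / n) powr (1 / 2) * \<parallel>h\<parallel>\<^sub>p\<close>. The argument works for functions with
  values in any real inner product space, which covers real and complex scalars at once.

  For the optimality of \<open>p / ln p\<close>, the inequality is tested on the sum of the first \<open>m\<close> coordinates with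
  \<open>k = m\<close> and \<open>n = m ^ 3\<close>. The right-hand side is at most \<open>2 * K\<close>, while the single set \<open>{1..m}\<close> and the single
  sign pattern with \<open>m\<close> ones already make the left-hand side at least \<open>m * (2 * m ^ 3) powr (- m / p)\<close>.
  For \<open>m\<close> the integer part of \<open>p / ln p\<close> this is \<open>m\<close> up to a universal factor.
\<close>

section \<open>Inequalities for powers and norms\<close>

text \<open>
  Convexity of \<open>t powr q\<close> on the closed half-line, from Young's inequality for \<open>t\<close> and \<open>m powr (q - 1)\<close>.
  It serves twice: averaged in \<open>t\<close> it is Jensen's inequality for norms, and with \<open>t = m + g\<close> it is the
  Bernoulli inequality that integrates the recursion over the size of the set.
\<close>

lemma powr_above_tangent:
  fixes t m q :: real
  assumes "t \<ge> 0" "m > 0" "q \<ge> 1"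
  shows "m powr q + q * m powr (q - 1) * (t - m) \<le> t powr q"
proof -
  have m: "m powr (q - 1) * m = m powr q"
    using assms by (simp add: powr_diff)
  show ?thesis
  proof (cases "t = 0")
    case True
    have "m powr q \<le> q * m powr q"
      using assms by (simp add: mult_le_cancel_right1)
    with True m show ?thesis by (simp add: algebra_simps)
  next
    case False
    then have "(t powr q) powr (1 / q) * (m powr q) powr (1 - 1 / q)
        \<le> 1 / q * t powr q + (1 - 1 / q) * m powr q"
      using assms by (intro Youngs_inequality_0) auto
    also have "(t powr q) powr (1 / q) * (m powr q) powr (1 - 1 / q) = t * m powr (q - 1)"
      using False assms by (simp add: powr_powr right_diff_distrib)
    finally have "q * (t * m powr (q - 1)) \<le> q * (1 / q * t powr q + (1 - 1 / q) * m powr q)"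
      using assms by (intro mult_left_mono) auto
    then have "q * (t * m powr (q - 1)) \<le> t powr q + q * m powr q - m powr q"
      using assms by (simp add: algebra_simps)
    with m show ?thesis by (simp add: algebra_simps)
  qed
qed

text \<open>
  The pointwise form of Hoelder's inequality with exponents \<open>p / (p - 2)\<close> and \<open>p / 2\<close>: if \<open>X\<close> and \<open>Y\<close>
  bound the \<open>p\<close>-norms of \<open>x\<close> and \<open>y\<close> for some average, then the last factor averages to at most
  \<open>1\<close>. Keeping \<open>X\<close> and \<open>Y\<close> free allows averaging over points and over sets in one go.
\<close>

lemma powr_mult_square_le:
  fixes x y X Y p :: real
  assumes "x \<ge> 0" "y \<ge> 0" "X > 0" "Y > 0" "p \<ge> 2"
  shows "x powr (p - 2) * y\<^sup>2
    \<le> X powr (p - 2) * Y\<^sup>2 * ((p - 2) / p * (x powr p / X powr p) + 2 / p * (y powr p / Y powr p))"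
proof (cases "x = 0 \<or> y = 0")
  case True
  then have "x powr (p - 2) * y\<^sup>2 = 0" by auto
  also have "0 \<le> X powr (p - 2) * Y\<^sup>2 * ((p - 2) / p * (x powr p / X powr p) + 2 / p * (y powr p / Y powr p))"
    using assms by simp
  finally show ?thesis .
next
  case False
  with assms have pos: "x > 0" "y > 0" by auto
  have "(x powr p / X powr p) powr ((p - 2) / p) * (y powr p / Y powr p) powr (2 / p)
      \<le> (p - 2) / p * (x powr p / X powr p) + 2 / p * (y powr p / Y powr p)"
    using assms pos by (intro Youngs_inequality_0) (auto simp: field_simps)
  also have "(x powr p / X powr p) powr ((p - 2) / p) = x powr (p - 2) / X powr (p - 2)"
    using assms pos by (simp add: powr_divide powr_powr)
  also have "(y powr p / Y powr p) powr (2 / p) = y\<^sup>2 / Y\<^sup>2"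
    using assms pos by (simp add: powr_divide powr_powr flip: powr_numeral)
  finally have "X powr (p - 2) * Y\<^sup>2 * (x powr (p - 2) / X powr (p - 2) * (y\<^sup>2 / Y\<^sup>2))
      \<le> X powr (p - 2) * Y\<^sup>2 * ((p - 2) / p * (x powr p / X powr p) + 2 / p * (y powr p / Y powr p))"
    by (intro mult_left_mono) auto
  then show ?thesis using assms by simp
qed

lemma exp_le_one_plus_mult_exp: "exp (y::real) \<le> 1 + y * exp y"
  using exp_ge_add_one_self[of "- y"] mult_left_mono[of "1 - y" "exp (- y)" "exp y"]
  by (simp add: algebra_simps flip: exp_add)

text \<open>
  Both sides are compared through \<open>cosh y - 1 = exp (- y) * (exp y - 1)\<^sup>2 / 2\<close>.
\<close>

lemma cosh_le_one_plus_square_mult_exp: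
  assumes "y \<ge> (0::real)"
  shows "cosh y \<le> 1 + y\<^sup>2 / 2 * exp y"
proof -
  have "1 \<le> exp y" using assms by simp
  then have "(exp y - 1)\<^sup>2 \<le> (y * exp y)\<^sup>2"
    using exp_le_one_plus_mult_exp[of y] by (intro power_mono) auto
  then have "exp (- y) * (exp y - 1)\<^sup>2 \<le> exp (- y) * (y * exp y)\<^sup>2"
    by (intro mult_left_mono) auto
  also have "exp (- y) * (y * exp y)\<^sup>2 = y\<^sup>2 * exp y"
    by (simp add: power2_eq_square exp_minus field_simps)
  also have "exp (- y) * (exp y - 1)\<^sup>2 = 2 * (cosh y - 1)"
    by (simp add: power2_eq_square exp_minus cosh_def field_simps)
  finally show ?thesis by simp
qed

lemma powr_one_plus_le_exp:
  fixes z q :: real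
  assumes "z \<ge> -1" "q \<ge> 0"
  shows "(1 + z) powr q \<le> exp (q * z)"
proof -
  have "(1 + z) powr q \<le> exp z powr q"
    using assms exp_ge_add_one_self[of z] by (intro powr_mono2) auto
  then show ?thesis by (simp add: powr_def mult.commute)
qed

text \<open>
  Put \<open>s = norm c / norm x\<close> and \<open>t = (x \<bullet> c) / (norm x)\<^sup>2\<close>, so that
  \<open>(norm (x \<plusminus> c))\<^sup>2 = (norm x)\<^sup>2 * (1 + s\<^sup>2 \<plusminus> 2 * t)\<close>. Bounding \<open>1 + z\<close> by \<open>exp z\<close> before symmetrizing
  turns the first-order terms into \<open>cosh (p * t)\<close>, which exceeds \<open>1\<close> only to second order. The bound
  is good as long as \<open>p * s\<close> is at most of order \<open>ln p\<close>.
\<close>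

lemma symmetrized_norm_powr_small_jump:
  fixes x c :: "'a::real_inner"
  assumes p: "p \<ge> 2" and x: "x \<noteq> 0" and c: "norm c \<le> norm x"
  shows "(norm (x + c) powr p + norm (x - c) powr p) / 2
    \<le> norm x powr p + p\<^sup>2 * exp (3 / 2 * (p * (norm c / norm x))) * norm x powr (p - 2) * (norm c)\<^sup>2"
proof -
  define s where "s = norm c / norm x"
  define t where "t = (x \<bullet> c) / (norm x)\<^sup>2"
  have N: "norm x > 0" using x by simp
  have s: "0 \<le> s" "s \<le> 1" using c N by (auto simp: s_def)
  have t: "\<bar>t\<bar> \<le> s"
    using Cauchy_Schwarz_ineq2[of x c] N
    by (simp add: t_def s_def field_simps power2_eq_square)
  have half: "norm z powr p = ((norm z)\<^sup>2) powr (p / 2)" for z :: 'a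
    using powr_powr[of "norm z" 2 "p / 2"] by (simp add: powr_numeral)
  have norms: "(norm (x + c))\<^sup>2 = (norm x)\<^sup>2 * (1 + (s\<^sup>2 + 2 * t))"
              "(norm (x - c))\<^sup>2 = (norm x)\<^sup>2 * (1 + (s\<^sup>2 - 2 * t))"
    using N by (auto simp: s_def t_def power2_norm_eq_inner inner_add inner_diff inner_commute
        field_simps power_divide)
  have ge: "0 \<le> 1 + (s\<^sup>2 + 2 * t)" "0 \<le> 1 + (s\<^sup>2 - 2 * t)"
    using norms N by (metis zero_le_power2 zero_le_mult_iff not_le zero_less_power)+
  have "(1 + (s\<^sup>2 + 2 * t)) powr (p / 2) + (1 + (s\<^sup>2 - 2 * t)) powr (p / 2)
     \<le> exp (p / 2 * (s\<^sup>2 + 2 * t)) + exp (p / 2 * (s\<^sup>2 - 2 * t))"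
    using ge p by (intro add_mono powr_one_plus_le_exp) auto
  also have "\<dots> = 2 * (exp (p * s\<^sup>2 / 2) * cosh (p * t))"
    by (simp add: cosh_def exp_add[symmetric] exp_diff distrib_left right_diff_distrib field_simps
        flip: exp_minus)
  also have "cosh (p * t) = cosh \<bar>p * t\<bar>" by simp
  also have "cosh \<bar>p * t\<bar> \<le> cosh (p * s)"
    using t p s by (subst cosh_real_nonneg_le_iff) (auto simp: abs_mult)
  finally have A: "(1 + (s\<^sup>2 + 2 * t)) powr (p / 2) + (1 + (s\<^sup>2 - 2 * t)) powr (p / 2)
      \<le> 2 * (exp (p * s\<^sup>2 / 2) * cosh (p * s))" by simp
  \<comment> \<open>The two factors contribute \<open>p * s / 2\<close> and \<open>p * s\<close> to the exponent in the final bound.\<close>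
  have ss: "s\<^sup>2 \<le> s" using s by (simp add: power2_eq_square mult_left_le)
  have e1: "exp (p * s\<^sup>2 / 2) \<le> exp (p * s / 2)" using ss p by simp
  have "exp (p * s\<^sup>2 / 2) * cosh (p * s)
     = (exp (p * s\<^sup>2 / 2) - 1) * cosh (p * s) + cosh (p * s)" by (simp add: algebra_simps)
  also have "\<dots> \<le> (p * s\<^sup>2 / 2 * exp (p * s / 2)) * exp (p * s) + (1 + (p * s)\<^sup>2 / 2 * exp (p * s))"
  proof (intro add_mono mult_mono)
    have "exp (p * s\<^sup>2 / 2) \<le> 1 + p * s\<^sup>2 / 2 * exp (p * s\<^sup>2 / 2)"
      by (rule exp_le_one_plus_mult_exp)
    also have "\<dots> \<le> 1 + p * s\<^sup>2 / 2 * exp (p * s / 2)"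
      using e1 p by (intro add_mono mult_left_mono) auto
    finally show "exp (p * s\<^sup>2 / 2) - 1 \<le> p * s\<^sup>2 / 2 * exp (p * s / 2)" by simp
    show "cosh (p * s) \<le> exp (p * s)"
      using s p by (simp add: cosh_def)
    show "cosh (p * s) \<le> 1 + (p * s)\<^sup>2 / 2 * exp (p * s)"
      using s p by (intro cosh_le_one_plus_square_mult_exp) auto
  qed (use s p in auto)
  also have "\<dots> \<le> 1 + p\<^sup>2 * s\<^sup>2 * exp (3 / 2 * (p * s))"
  proof -
    have "p * s\<^sup>2 / 2 * exp (p * s / 2) * exp (p * s) = p * s\<^sup>2 / 2 * exp (3 / 2 * (p * s))"
      by (simp add: mult.assoc flip: exp_add)
    also have "\<dots> \<le> p\<^sup>2 * s\<^sup>2 / 2 * exp (3 / 2 * (p * s))"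
      using p by (intro mult_right_mono divide_right_mono) (auto simp: power2_eq_square)
    finally have 1: "p * s\<^sup>2 / 2 * exp (p * s / 2) * exp (p * s) \<le> p\<^sup>2 * s\<^sup>2 / 2 * exp (3 / 2 * (p * s))" .
    have 2: "(p * s)\<^sup>2 / 2 * exp (p * s) \<le> p\<^sup>2 * s\<^sup>2 / 2 * exp (3 / 2 * (p * s))"
      using p s by (auto simp: power_mult_distrib intro!: mult_left_mono)
    show ?thesis using 1 2 by simp
  qed
  finally have B: "exp (p * s\<^sup>2 / 2) * cosh (p * s) \<le> 1 + p\<^sup>2 * s\<^sup>2 * exp (3 / 2 * (p * s))" .
  have "(norm (x + c) powr p + norm (x - c) powr p) / 2
      = norm x powr p * (((1 + (s\<^sup>2 + 2 * t)) powr (p / 2) + (1 + (s\<^sup>2 - 2 * t)) powr (p / 2)) / 2)"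
    unfolding half norms powr_mult
    by (simp only: distrib_left times_divide_eq_right)
  also have "\<dots> \<le> norm x powr p * (1 + p\<^sup>2 * s\<^sup>2 * exp (3 / 2 * (p * s)))"
    using A B by (intro mult_left_mono) auto
  also have "\<dots> = norm x powr p + p\<^sup>2 * exp (3 / 2 * (p * s)) * norm x powr (p - 2) * (norm c)\<^sup>2"
    using N by (simp add: powr_diff powr_numeral s_def field_simps power_divide)
  finally show ?thesis unfolding s_def .
qed

text \<open>
  The source of the constant \<open>p / ln p\<close>. A jump \<open>c\<close> that is short compared with \<open>x\<close> costs a
  second-order term, at the price of a small additional power of \<open>p\<close>; a longer jump dominates \<open>x\<close> up to
  a multiple of \<open>p / ln p\<close>, so then the whole left-hand side is charged to \<open>norm c powr p\<close>.
\<close>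

lemma symmetrized_norm_powr_le:
  fixes x c :: "'a::real_inner"
  assumes p: "p \<ge> 2"
  shows "(norm (x + c) powr p + norm (x - c) powr p) / 2
    \<le> norm x powr p + p powr (5 / 2) * norm x powr (p - 2) * (norm c)\<^sup>2
       + (4 * (p / ln p)) powr p * norm c powr p"
proof -
  have ln: "ln p > 0" "ln p \<le> p" using p ln_bound[of p] by auto
  \<comment> \<open>The threshold at which the exponential factor of the small-jump bound becomes \<open>sqrt p\<close>.\<close>
  define \<delta> where "\<delta> = ln p / (3 * p)"
  have \<delta>: "\<delta> > 0" "\<delta> \<le> 1" using ln p by (auto simp: \<delta>_def)
  show ?thesis
  proof (cases "x \<noteq> 0 \<and> norm c \<le> \<delta> * norm x")
    case True
    then have x: "norm x > 0" by auto
    have r: "norm c / norm x \<le> \<delta>" using True x by (simp add: field_simps)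
    have "\<delta> * norm x \<le> norm x" using \<delta> x by (simp add: mult_left_le_one_le)
    with True have le: "norm c \<le> norm x" by linarith
    have "exp (3 / 2 * (p * (norm c / norm x))) \<le> exp (3 / 2 * (p * \<delta>))"
      using r p by (subst exp_le_cancel_iff, intro mult_left_mono) auto
    also have "3 / 2 * (p * \<delta>) = 1 / 2 * ln p" using p by (simp add: \<delta>_def)
    also have "exp (1 / 2 * ln p) = p powr (1 / 2)" using p by (simp add: powr_def)
    finally have "p\<^sup>2 * exp (3 / 2 * (p * (norm c / norm x))) \<le> p powr 2 * p powr (1 / 2)"
      using p by (simp add: powr_numeral)
    also have "\<dots> = p powr (5 / 2)" by (simp flip: powr_add)
    finally have "p\<^sup>2 * exp (3 / 2 * (p * (norm c / norm x))) * norm x powr (p - 2) * (norm c)\<^sup>2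
        \<le> p powr (5 / 2) * norm x powr (p - 2) * (norm c)\<^sup>2"
      by (intro mult_right_mono) auto
    moreover have "0 \<le> (4 * (p / ln p)) powr p * norm c powr p" by simp
    ultimately show ?thesis using symmetrized_norm_powr_small_jump[OF p conjunct1[OF True] le] by linarith
  next
    case False
    define b where "b = p / ln p * norm c"
    have "norm x \<le> 3 * b"
    proof (cases "x = 0")
      case True with p ln show ?thesis by (simp add: b_def)
    next
      case x: False
      with False show ?thesis using ln p by (auto simp: \<delta>_def b_def field_simps)
    qed
    moreover have "norm c \<le> b"
      using ln mult_right_mono[of 1 "p / ln p" "norm c"] by (simp add: b_def)
    ultimately have "norm x + norm c \<le> 4 * b" by linarith
    then have sum: "norm x + norm c \<le> 4 * (p / ln p) * norm c" by (simp add: b_def)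
    have mean_le: "(a + b) / 2 \<le> m" if "a \<le> m" "b \<le> m" for a b m :: real
      using that by simp
    have "norm (x + c) powr p \<le> (4 * (p / ln p) * norm c) powr p"
      using sum p norm_triangle_ineq[of x c] by (intro powr_mono2) auto
    moreover have "norm (x - c) powr p \<le> (4 * (p / ln p) * norm c) powr p"
      using sum p norm_triangle_ineq4[of x c] by (intro powr_mono2) auto
    ultimately have "(norm (x + c) powr p + norm (x - c) powr p) / 2
        \<le> (4 * (p / ln p) * norm c) powr p" by (rule mean_le)
    then have "(norm (x + c) powr p + norm (x - c) powr p) / 2
        \<le> (4 * (p / ln p)) powr p * norm c powr p" by (simp only: powr_mult[of _ "norm c"])
    moreover have "0 \<le> norm x powr p + p powr (5 / 2) * norm x powr (p - 2) * (norm c)\<^sup>2" by simp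
    ultimately show ?thesis by linarith
  qed
qed

section \<open>Averages and projections on the discrete cube\<close>

text \<open>
  The set over which the projection onto the coordinates in \<open>S\<close> averages.
\<close>

definition fiber :: "nat \<Rightarrow> nat set \<Rightarrow> (nat \<Rightarrow> real) \<Rightarrow> (nat \<Rightarrow> real) set" where
  "fiber n S \<epsilon> = {\<eta> \<in> cube n. \<forall>j\<in>S. \<eta> j = \<epsilon> j}"

abbreviation flip :: "nat \<Rightarrow> (nat \<Rightarrow> real) \<Rightarrow> nat \<Rightarrow> real" where
  "flip j \<epsilon> \<equiv> \<epsilon>(j := - \<epsilon> j)"

lemma cube_proj_eq_average_fiber: "cube_proj n S h \<epsilon> = average (fiber n S \<epsilon>) h"
  by (simp add: cube_proj_def fiber_def)

lemma finite_cube: "finite (cube n)"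
  unfolding cube_def by (intro finite_PiE) auto

lemma finite_fiber [simp]: "finite (fiber n S \<epsilon>)"
  using finite_cube by (simp add: fiber_def)

lemma cube_nonempty: "cube n \<noteq> {}"
  unfolding cube_def by (simp add: PiE_eq_empty_iff)

lemma self_mem_fiber: "\<epsilon> \<in> cube n \<Longrightarrow> \<epsilon> \<in> fiber n S \<epsilon>"
  by (simp add: fiber_def)

lemma cube_cases: "\<epsilon> \<in> cube n \<Longrightarrow> j \<in> {1..n} \<Longrightarrow> \<epsilon> j = 1 \<or> \<epsilon> j = -1"
  by (auto simp: cube_def PiE_iff)

lemma fiber_cases: "\<eta> \<in> fiber n S \<epsilon> \<Longrightarrow> j \<in> {1..n} \<Longrightarrow> \<eta> j = 1 \<or> \<eta> j = -1"
  using cube_cases by (auto simp: fiber_def)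

lemma flip_mem_cube: "\<epsilon> \<in> cube n \<Longrightarrow> j \<in> {1..n} \<Longrightarrow> flip j \<epsilon> \<in> cube n"
  by (auto simp: cube_def PiE_iff extensional_def)

lemma sum_fiber_flip:
  assumes "j \<in> {1..n}" "j \<notin> S"
  shows "(\<Sum>\<eta>\<in>fiber n S \<epsilon>. f (flip j \<eta>)) = (\<Sum>\<eta>\<in>fiber n S \<epsilon>. f \<eta>)"
  using assms
  by (intro sum.reindex_bij_witness[of _ "flip j" "flip j"])
     (auto simp: fiber_def intro: flip_mem_cube)

lemma average_cube_flip:
  "j \<in> {1..n} \<Longrightarrow> average (cube n) (\<lambda>\<epsilon>. f (flip j \<epsilon>)) = average (cube n) f"
  unfolding average_def using sum_fiber_flip[of j n "{}" f "\<lambda>_. 0"] by (simp add: fiber_def)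

lemma average_cong: "(\<And>x. x \<in> A \<Longrightarrow> f x = g x) \<Longrightarrow> average A f = average A g"
  unfolding average_def by (simp cong: sum.cong)

lemma average_add: "average A (\<lambda>x. f x + g x) = average A f + average A g"
  unfolding average_def by (simp add: sum.distrib scaleR_add_right)

lemma average_scaleR: "average A (\<lambda>x. c *\<^sub>R f x) = c *\<^sub>R average A f"
  unfolding average_def by (simp add: scaleR_right.sum mult.commute)

lemma average_cmult: "average A (\<lambda>x. c * f x) = c * average A f" for c :: real
  using average_scaleR[of A c f] by simp

lemma average_sum: "average A (\<lambda>x. \<Sum>i\<in>I. f i x) = (\<Sum>i\<in>I. average A (f i))"
  unfolding average_def by (simp add: scaleR_right.sum sum.swap[of _ I A])

lemma average_mono:
  fixes f g :: "'b \<Rightarrow> real"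
  shows "(\<And>x. x \<in> A \<Longrightarrow> f x \<le> g x) \<Longrightarrow> average A f \<le> average A g"
  unfolding average_def by (intro scaleR_left_mono sum_mono) auto

lemma average_nonneg:
  fixes f :: "'b \<Rightarrow> real"
  shows "(\<And>x. x \<in> A \<Longrightarrow> 0 \<le> f x) \<Longrightarrow> 0 \<le> average A f"
  unfolding average_def by (simp add: sum_nonneg)

lemma average_const:
  assumes "finite A" "A \<noteq> {}"
  shows "average A (\<lambda>x. c) = c"
  using assms unfolding average_def by (simp add: sum_constant_scaleR)

text \<open>
  Jensen's inequality: the tangent to \<open>t powr p\<close> at the average of the norms is averaged.
\<close>

lemma norm_average_powr_le:
  fixes f :: "'b \<Rightarrow> 'a::real_normed_vector"
  assumes "finite A" "A \<noteq> {}" "p \<ge> 1"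
  shows "norm (average A f) powr p \<le> average A (\<lambda>x. norm (f x) powr p)"
proof -
  define m where "m = average A (\<lambda>x. norm (f x))"
  have le: "norm (average A f) \<le> m"
    unfolding average_def m_def by (simp add: norm_sum mult_left_mono)
  have "norm (average A f) powr p \<le> m powr p"
    using le assms by (intro powr_mono2) auto
  also have "m powr p \<le> average A (\<lambda>x. norm (f x) powr p)"
  proof (cases "m > 0")
    case True
    have "m powr p = average A (\<lambda>x. (m powr p - p * m powr (p - 1) * m) + p * m powr (p - 1) * norm (f x))"
      using assms unfolding average_add average_cmult average_const[OF assms(1,2)] by (simp add: m_def)
    also have "\<dots> \<le> average A (\<lambda>x. norm (f x) powr p)"
    proof (intro average_mono)
      fix x
      show "(m powr p - p * m powr (p - 1) * m) + p * m powr (p - 1) * norm (f x) \<le> norm (f x) powr p"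
        using powr_above_tangent[of "norm (f x)" m p] True assms by (simp add: algebra_simps)
    qed
    finally show ?thesis .
  next
    case False
    then have "m = 0" using le norm_ge_zero[of "average A f"] by linarith
    then show ?thesis by (simp add: average_nonneg)
  qed
  finally show ?thesis .
qed

lemma fiber_eq: "\<eta> \<in> fiber n S \<epsilon> \<Longrightarrow> fiber n S \<eta> = fiber n S \<epsilon>"
  by (auto simp: fiber_def)

text \<open>
  Agreement on \<open>S\<close> is an equivalence relation on the cube, so the order of the two summations can be
  exchanged. In other words, the projection is a self-adjoint operator that fixes \<open>\<phi>\<close>.
\<close>

lemma average_mult_cube_proj:
  fixes \<phi> g :: "(nat \<Rightarrow> real) \<Rightarrow> real"
  assumes "\<And>\<epsilon> \<eta>. \<eta> \<in> fiber n S \<epsilon> \<Longrightarrow> \<phi> \<eta> = \<phi> \<epsilon>"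
  shows "average (cube n) (\<lambda>\<epsilon>. \<phi> \<epsilon> * cube_proj n S g \<epsilon>) = average (cube n) (\<lambda>\<epsilon>. \<phi> \<epsilon> * g \<epsilon>)"
proof -
  have mem: "\<eta> \<in> fiber n S \<epsilon> \<longleftrightarrow> \<epsilon> \<in> fiber n S \<eta>" if "\<epsilon> \<in> cube n" "\<eta> \<in> cube n" for \<epsilon> \<eta>
    using that by (auto simp: fiber_def)
  have "(\<Sum>\<epsilon>\<in>cube n. \<phi> \<epsilon> * cube_proj n S g \<epsilon>)
      = (\<Sum>\<epsilon>\<in>cube n. \<Sum>\<eta> | \<eta> \<in> cube n \<and> \<eta> \<in> fiber n S \<epsilon>. \<phi> \<epsilon> * g \<eta> / real (card (fiber n S \<epsilon>)))"
  proof (intro sum.cong refl)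
    fix \<epsilon>
    have "{\<eta>. \<eta> \<in> cube n \<and> \<eta> \<in> fiber n S \<epsilon>} = fiber n S \<epsilon>" by (auto simp: fiber_def)
    then show "\<phi> \<epsilon> * cube_proj n S g \<epsilon>
      = (\<Sum>\<eta> | \<eta> \<in> cube n \<and> \<eta> \<in> fiber n S \<epsilon>. \<phi> \<epsilon> * g \<eta> / real (card (fiber n S \<epsilon>)))"
      by (simp add: cube_proj_eq_average_fiber average_def divide_inverse sum_distrib_left sum_distrib_right mult_ac)
  qed
  also have "\<dots> = (\<Sum>\<eta>\<in>cube n. \<Sum>\<epsilon> | \<epsilon> \<in> cube n \<and> \<eta> \<in> fiber n S \<epsilon>. \<phi> \<epsilon> * g \<eta> / real (card (fiber n S \<epsilon>)))"
    by (rule sum.swap_restrict) (auto simp: finite_cube)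
  also have "\<dots> = (\<Sum>\<eta>\<in>cube n. \<phi> \<eta> * g \<eta>)"
  proof (intro sum.cong refl)
    fix \<eta> assume \<eta>: "\<eta> \<in> cube n"
    have "card (fiber n S \<eta>) \<noteq> 0" using self_mem_fiber[OF \<eta>] by auto
    moreover have "{\<epsilon>. \<epsilon> \<in> cube n \<and> \<eta> \<in> fiber n S \<epsilon>} = fiber n S \<eta>"
      using \<eta> mem by (auto simp: fiber_def)
    moreover have "(\<Sum>\<epsilon>\<in>fiber n S \<eta>. \<phi> \<epsilon> * g \<eta> / real (card (fiber n S \<epsilon>)))
        = (\<Sum>\<epsilon>\<in>fiber n S \<eta>. \<phi> \<eta> * g \<eta> / real (card (fiber n S \<eta>)))"
      by (intro sum.cong refl) (metis assms fiber_eq)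
    ultimately show "(\<Sum>\<epsilon> | \<epsilon> \<in> cube n \<and> \<eta> \<in> fiber n S \<epsilon>. \<phi> \<epsilon> * g \<eta> / real (card (fiber n S \<epsilon>))) = \<phi> \<eta> * g \<eta>"
      by simp
  qed
  finally show ?thesis by (simp add: average_def)
qed

lemma average_cube_proj: "average (cube n) (cube_proj n S g) = average (cube n) g"
  for g :: "(nat \<Rightarrow> real) \<Rightarrow> real"
  using average_mult_cube_proj[of n S "\<lambda>_. 1" g] by simp

lemma norm_cube_proj_powr_le:
  assumes "\<epsilon> \<in> cube n" "p \<ge> 1"
  shows "norm (cube_proj n S h \<epsilon>) powr p \<le> cube_proj n S (\<lambda>\<eta>. norm (h \<eta>) powr p) \<epsilon>"
  unfolding cube_proj_eq_average_fiber
  using assms self_mem_fiber by (intro norm_average_powr_le) auto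

lemma average_norm_cube_proj_powr_le:
  assumes "p \<ge> 1"
  shows "average (cube n) (\<lambda>\<epsilon>. norm (cube_proj n S h \<epsilon>) powr p)
    \<le> average (cube n) (\<lambda>\<epsilon>. norm (h \<epsilon>) powr p)"
proof -
  have "average (cube n) (\<lambda>\<epsilon>. norm (cube_proj n S h \<epsilon>) powr p)
      \<le> average (cube n) (cube_proj n S (\<lambda>\<eta>. norm (h \<eta>) powr p))"
    using assms by (intro average_mono norm_cube_proj_powr_le)
  then show ?thesis by (simp add: average_cube_proj)
qed

section \<open>Revealing one more coordinate\<close>

text \<open>
  The Walsh coefficient of order one, in the coordinate \<open>j\<close>, of \<open>h\<close> as a function of the coordinates
  outside \<open>S\<close>. It is constant on fibers of \<open>S\<close>.
\<close>

definition increment :: "nat \<Rightarrow> nat set \<Rightarrow> nat \<Rightarrow> ((nat \<Rightarrow> real) \<Rightarrow> 'a::real_normed_vector) \<Rightarrow>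
    (nat \<Rightarrow> real) \<Rightarrow> 'a" where
  "increment n S j h = cube_proj n S (\<lambda>\<eta>. \<eta> j *\<^sub>R h \<eta>)"

lemma sum_fiber_coordinate:
  assumes "j \<in> {1..n}" "j \<notin> S"
  shows "(\<Sum>\<eta>\<in>fiber n S \<epsilon>. \<eta> j) = 0"
  using sum_fiber_flip[OF assms, of "\<lambda>\<eta>. \<eta> j" \<epsilon>] by (simp add: sum_negf)

text \<open>
  On the fiber of \<open>S\<close> the weight \<open>1 + \<epsilon> j * \<eta> j\<close> is \<open>2\<close> on the fiber of \<open>insert j S\<close> and \<open>0\<close> elsewhere,
  and the smaller fiber is half of the larger one.
\<close>

lemma cube_proj_insert:
  assumes \<epsilon>: "\<epsilon> \<in> cube n" and j: "j \<in> {1..n}" "j \<notin> S"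
  shows "cube_proj n (insert j S) h \<epsilon> = cube_proj n S h \<epsilon> + \<epsilon> j *\<^sub>R increment n S j h \<epsilon>"
proof -
  let ?F = "fiber n S \<epsilon>" and ?G = "fiber n (insert j S) \<epsilon>"
  have G: "?G = {\<eta> \<in> ?F. \<eta> j = \<epsilon> j}" by (auto simp: fiber_def)
  have weight: "1 + \<epsilon> j * \<eta> j = (if \<eta> j = \<epsilon> j then 2 else 0)" if "\<eta> \<in> ?F" for \<eta>
    using cube_cases[OF \<epsilon> j(1)] fiber_cases[OF that j(1)] by auto
  have restrict: "(\<Sum>\<eta>\<in>?F. (1 + \<epsilon> j * \<eta> j) *\<^sub>R f \<eta>) = 2 *\<^sub>R (\<Sum>\<eta>\<in>?G. f \<eta>)"
    for f :: "_ \<Rightarrow> 'c::real_normed_vector"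
  proof -
    have "(\<Sum>\<eta>\<in>?F. (1 + \<epsilon> j * \<eta> j) *\<^sub>R f \<eta>) = (\<Sum>\<eta>\<in>?F. if \<eta> j = \<epsilon> j then 2 *\<^sub>R f \<eta> else 0)"
      by (intro sum.cong refl) (simp add: weight)
    also have "\<dots> = (\<Sum>\<eta>\<in>?G. 2 *\<^sub>R f \<eta>)"
      unfolding G by (rule sum.inter_filter[symmetric]) simp
    finally show ?thesis by (simp add: scaleR_right.sum)
  qed
  have "real (card ?F) = (\<Sum>\<eta>\<in>?F. (1 + \<epsilon> j * \<eta> j) *\<^sub>R (1::real))"
    using sum_fiber_coordinate[OF j] by (simp add: sum.distrib flip: sum_distrib_left)
  then have card: "real (card ?F) = 2 * real (card ?G)" using restrict[of "\<lambda>_. 1::real"] by simp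
  have "cube_proj n S h \<epsilon> + \<epsilon> j *\<^sub>R increment n S j h \<epsilon>
      = (\<Sum>\<eta>\<in>?F. (1 + \<epsilon> j * \<eta> j) *\<^sub>R h \<eta>) /\<^sub>R real (card ?F)"
    unfolding increment_def cube_proj_eq_average_fiber average_scaleR[symmetric] average_add[symmetric]
    by (simp add: average_def scaleR_add_left)
  also have "\<dots> = cube_proj n (insert j S) h \<epsilon>"
    unfolding restrict card cube_proj_eq_average_fiber average_def by simp
  finally show ?thesis ..
qed

lemma cube_proj_cong: "(\<And>i. i \<in> S \<Longrightarrow> \<epsilon> i = \<epsilon>' i) \<Longrightarrow> cube_proj n S h \<epsilon> = cube_proj n S h \<epsilon>'"
  unfolding cube_proj_def by (rule arg_cong[where f = "\<lambda>A. average A h"]) auto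

lemma cube_proj_fiber: "\<eta> \<in> fiber n S \<epsilon> \<Longrightarrow> cube_proj n S h \<eta> = cube_proj n S h \<epsilon>"
  by (simp add: cube_proj_eq_average_fiber fiber_eq)

text \<open>
  Neither the old projection nor the increment depends on the sign of the coordinate \<open>j\<close>, so the jump
  is symmetric and its sign can be averaged out first.
\<close>

lemma average_norm_cube_proj_insert:
  assumes j: "j \<in> {1..n}" "j \<notin> S"
  shows "average (cube n) (\<lambda>\<epsilon>. norm (cube_proj n (insert j S) h \<epsilon>) powr p)
    = average (cube n) (\<lambda>\<epsilon>. (norm (cube_proj n S h \<epsilon> + increment n S j h \<epsilon>) powr p
        + norm (cube_proj n S h \<epsilon> - increment n S j h \<epsilon>) powr p) / 2)"
proof -
  let ?f = "\<lambda>\<epsilon>. norm (cube_proj n (insert j S) h \<epsilon>) powr p"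
  have "2 * average (cube n) ?f = average (cube n) (\<lambda>\<epsilon>. ?f \<epsilon> + ?f (flip j \<epsilon>))"
    using average_cube_flip[OF j(1), of ?f] by (simp only: average_add)
  also have "\<dots> = average (cube n) (\<lambda>\<epsilon>. norm (cube_proj n S h \<epsilon> + increment n S j h \<epsilon>) powr p
        + norm (cube_proj n S h \<epsilon> - increment n S j h \<epsilon>) powr p)"
  proof (intro average_cong)
    fix \<epsilon> assume \<epsilon>: "\<epsilon> \<in> cube n"
    have "cube_proj n S g (flip j \<epsilon>) = cube_proj n S g \<epsilon>" for g :: "_ \<Rightarrow> 'a"
      using j by (intro cube_proj_cong) auto
    then have "cube_proj n (insert j S) h (flip j \<epsilon>) = cube_proj n S h \<epsilon> - \<epsilon> j *\<^sub>R increment n S j h \<epsilon>"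
      using cube_proj_insert[OF flip_mem_cube[OF \<epsilon> j(1)] j, of h] by (simp add: increment_def)
    then show "?f \<epsilon> + ?f (flip j \<epsilon>) = norm (cube_proj n S h \<epsilon> + increment n S j h \<epsilon>) powr p
        + norm (cube_proj n S h \<epsilon> - increment n S j h \<epsilon>) powr p"
      using cube_proj_insert[OF \<epsilon> j, of h] cube_cases[OF \<epsilon> j(1)] by auto
  qed
  also have "\<dots> = 2 * average (cube n) (\<lambda>\<epsilon>. (norm (cube_proj n S h \<epsilon> + increment n S j h \<epsilon>) powr p
        + norm (cube_proj n S h \<epsilon> - increment n S j h \<epsilon>) powr p) / 2)"
    unfolding average_cmult[symmetric] by (intro average_cong) (simp add: field_simps)
  finally show ?thesis by simp
qed

text \<open>
  Fibers of \<open>S\<close> are invariant under the sign change of the coordinate \<open>j\<close>. Averaging the increment with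
  its image under that change replaces \<open>h\<close> by half of \<open>cube_deriv j h\<close>; then Jensen's inequality applies.
\<close>

lemma norm_increment_powr_le:
  assumes \<epsilon>: "\<epsilon> \<in> cube n" and j: "j \<in> {1..n}" "j \<notin> S" and p: "p \<ge> 1"
  shows "norm (increment n S j h \<epsilon>) powr p
    \<le> (1 / 2) powr p * cube_proj n S (\<lambda>\<eta>. norm (cube_deriv j h \<eta>) powr p) \<epsilon>"
proof -
  let ?F = "fiber n S \<epsilon>"
  have "(\<Sum>\<eta>\<in>?F. \<eta> j *\<^sub>R h (flip j \<eta>)) = - (\<Sum>\<eta>\<in>?F. \<eta> j *\<^sub>R h \<eta>)"
    using sum_fiber_flip[OF j, of "\<lambda>\<eta>. - (\<eta> j *\<^sub>R h \<eta>)" \<epsilon>] by (simp add: sum_negf)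
  then have "(\<Sum>\<eta>\<in>?F. \<eta> j *\<^sub>R cube_deriv j h \<eta>) = 2 *\<^sub>R (\<Sum>\<eta>\<in>?F. \<eta> j *\<^sub>R h \<eta>)"
    by (simp add: cube_deriv_def scaleR_diff_right sum_subtractf scaleR_2)
  then have "increment n S j h \<epsilon> = (1 / 2) *\<^sub>R cube_proj n S (\<lambda>\<eta>. \<eta> j *\<^sub>R cube_deriv j h \<eta>) \<epsilon>"
    by (simp add: increment_def cube_proj_eq_average_fiber average_def)
  then have "norm (increment n S j h \<epsilon>) powr p
      = (1 / 2) powr p * norm (cube_proj n S (\<lambda>\<eta>. \<eta> j *\<^sub>R cube_deriv j h \<eta>) \<epsilon>) powr p"
    by (simp add: powr_mult powr_divide)
  also have "\<dots> \<le> (1 / 2) powr p * cube_proj n S (\<lambda>\<eta>. norm (\<eta> j *\<^sub>R cube_deriv j h \<eta>) powr p) \<epsilon>"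
    by (intro mult_left_mono norm_cube_proj_powr_le[OF \<epsilon> p]) auto
  also have "cube_proj n S (\<lambda>\<eta>. norm (\<eta> j *\<^sub>R cube_deriv j h \<eta>) powr p) \<epsilon>
      = cube_proj n S (\<lambda>\<eta>. norm (cube_deriv j h \<eta>) powr p) \<epsilon>"
    unfolding cube_proj_eq_average_fiber
  proof (intro average_cong)
    fix \<eta> assume "\<eta> \<in> ?F"
    then have "\<bar>\<eta> j\<bar> = 1" using fiber_cases[OF _ j(1)] by fastforce
    then show "norm (\<eta> j *\<^sub>R cube_deriv j h \<eta>) powr p = norm (cube_deriv j h \<eta>) powr p" by simp
  qed
  finally show ?thesis .
qed

text \<open>
  Bessel's inequality: on a fiber of \<open>S\<close> the coordinates outside \<open>S\<close> are orthonormal, and the increments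
  are the coefficients of \<open>h\<close> with respect to them.
\<close>

lemma sum_norm_increment_square_le:
  fixes h :: "(nat \<Rightarrow> real) \<Rightarrow> 'a::real_inner"
  assumes \<epsilon>: "\<epsilon> \<in> cube n"
  shows "(\<Sum>j\<in>{1..n} - S. (norm (increment n S j h \<epsilon>))\<^sup>2) \<le> cube_proj n S (\<lambda>\<eta>. (norm (h \<eta>))\<^sup>2) \<epsilon>"
proof -
  let ?F = "fiber n S \<epsilon>" and ?J = "{1..n} - S"
  define N where "N = real (card ?F)"
  define c where "c j = increment n S j h \<epsilon>" for j
  have N: "N > 0" using self_mem_fiber[OF \<epsilon>, of S] by (auto simp: N_def card_gt_0_iff)
  have c: "(\<Sum>\<eta>\<in>?F. \<eta> j *\<^sub>R h \<eta>) = N *\<^sub>R c j" for j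
    using N by (simp add: c_def increment_def cube_proj_eq_average_fiber average_def flip: N_def)
  have orth: "(\<Sum>\<eta>\<in>?F. \<eta> i * \<eta> j) = (if i = j then N else 0)" if "i \<in> ?J" "j \<in> ?J" for i j
  proof (cases "i = j")
    case True
    have "\<eta> j * \<eta> j = 1" if "\<eta> \<in> ?F" for \<eta>
      using fiber_cases[OF that, of j] \<open>j \<in> ?J\<close> by auto
    then show ?thesis using True by (simp add: N_def)
  next
    case False
    then show ?thesis using sum_fiber_flip[of i n S "\<lambda>\<eta>. \<eta> i * \<eta> j" \<epsilon>] that by (simp add: sum_negf)
  qed
  have "0 \<le> (\<Sum>\<eta>\<in>?F. (norm (h \<eta> - (\<Sum>j\<in>?J. \<eta> j *\<^sub>R c j)))\<^sup>2)"
    by (intro sum_nonneg) auto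
  also have "\<dots> = (\<Sum>\<eta>\<in>?F. (norm (h \<eta>))\<^sup>2 - 2 * (\<Sum>j\<in>?J. (\<eta> j *\<^sub>R h \<eta>) \<bullet> c j)
      + (\<Sum>i\<in>?J. \<Sum>j\<in>?J. (\<eta> i * \<eta> j) * (c i \<bullet> c j)))"
    by (intro sum.cong refl)
       (simp add: power2_norm_eq_inner inner_diff inner_sum_left inner_sum_right inner_commute
         sum_distrib_left sum_negf mult_ac)
  also have "\<dots> = (\<Sum>\<eta>\<in>?F. (norm (h \<eta>))\<^sup>2) - 2 * (\<Sum>j\<in>?J. (\<Sum>\<eta>\<in>?F. \<eta> j *\<^sub>R h \<eta>) \<bullet> c j)
      + (\<Sum>i\<in>?J. \<Sum>j\<in>?J. (\<Sum>\<eta>\<in>?F. \<eta> i * \<eta> j) * (c i \<bullet> c j))"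
  proof -
    have 1: "(\<Sum>\<eta>\<in>?F. \<Sum>j\<in>?J. (\<eta> j *\<^sub>R h \<eta>) \<bullet> c j) = (\<Sum>j\<in>?J. (\<Sum>\<eta>\<in>?F. \<eta> j *\<^sub>R h \<eta>) \<bullet> c j)"
      unfolding inner_sum_left by (rule sum.swap)
    have 2: "(\<Sum>\<eta>\<in>?F. \<Sum>i\<in>?J. \<Sum>j\<in>?J. (\<eta> i * \<eta> j) * (c i \<bullet> c j))
        = (\<Sum>i\<in>?J. \<Sum>j\<in>?J. (\<Sum>\<eta>\<in>?F. \<eta> i * \<eta> j) * (c i \<bullet> c j))"
      unfolding sum_distrib_right sum.swap[of _ _ ?F] ..
    show ?thesis by (simp only: sum.distrib sum_subtractf sum_distrib_left[symmetric] 1 2)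
  qed
  also have "(\<Sum>j\<in>?J. (\<Sum>\<eta>\<in>?F. \<eta> j *\<^sub>R h \<eta>) \<bullet> c j) = N * (\<Sum>j\<in>?J. (norm (c j))\<^sup>2)"
    by (simp add: c power2_norm_eq_inner sum_distrib_left)
  also have "(\<Sum>i\<in>?J. \<Sum>j\<in>?J. (\<Sum>\<eta>\<in>?F. \<eta> i * \<eta> j) * (c i \<bullet> c j)) = N * (\<Sum>j\<in>?J. (norm (c j))\<^sup>2)"
  proof -
    have "(\<Sum>i\<in>?J. \<Sum>j\<in>?J. (\<Sum>\<eta>\<in>?F. \<eta> i * \<eta> j) * (c i \<bullet> c j))
        = (\<Sum>i\<in>?J. \<Sum>j\<in>?J. if i = j then N * (c i \<bullet> c j) else 0)"
      by (intro sum.cong refl) (simp add: orth)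
    then show ?thesis by (simp add: power2_norm_eq_inner sum_distrib_left)
  qed
  finally have "N * (\<Sum>j\<in>?J. (norm (c j))\<^sup>2) \<le> (\<Sum>\<eta>\<in>?F. (norm (h \<eta>))\<^sup>2)" by simp
  then have "(\<Sum>j\<in>?J. (norm (c j))\<^sup>2) \<le> (\<Sum>\<eta>\<in>?F. (norm (h \<eta>))\<^sup>2) / N"
    using N by (simp add: field_simps)
  then show ?thesis
    by (simp add: c_def cube_proj_eq_average_fiber average_def N_def field_simps)
qed

text \<open>
  The \<open>p\<close>-th power of the norm of the projection, without the root, since powers are what can be averaged
  over sets and compared between consecutive sizes.
\<close>

definition proj_energy ::
    "nat \<Rightarrow> real \<Rightarrow> ((nat \<Rightarrow> real) \<Rightarrow> 'a::real_normed_vector) \<Rightarrow> nat set \<Rightarrow> real" where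
  "proj_energy n p h S = average (cube n) (\<lambda>\<epsilon>. norm (cube_proj n S h \<epsilon>) powr p)"

text \<open>
  The effect of revealing one more coordinate, summed over its choice. The mixed second-order term
  contains the projection of the square of \<open>h\<close>; by self-adjointness \<open>h\<close> itself may take its place.
\<close>

lemma sum_proj_energy_insert_le:
  fixes h :: "(nat \<Rightarrow> real) \<Rightarrow> 'a::real_inner"
  assumes p: "p \<ge> 2"
  shows "(\<Sum>j\<in>{1..n} - S. proj_energy n p h (insert j S))
    \<le> real (card ({1..n} - S)) * proj_energy n p h S
      + p powr (5 / 2) * average (cube n) (\<lambda>\<epsilon>. norm (cube_proj n S h \<epsilon>) powr (p - 2) * (norm (h \<epsilon>))\<^sup>2)
      + (2 * (p / ln p)) powr p
        * (\<Sum>j\<in>{1..n} - S. average (cube n) (\<lambda>\<epsilon>. norm (cube_deriv j h \<epsilon>) powr p))"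
proof -
  let ?J = "{1..n} - S" and ?x = "cube_proj n S h" and ?c = "\<lambda>j. increment n S j h"
  let ?D = "\<lambda>j \<epsilon>. norm (cube_deriv j h \<epsilon>) powr p"
  have half: "(4 * (p / ln p)) powr p * ((1 / 2) powr p * d) = (2 * (p / ln p)) powr p * d" for d :: real
    using p powr_mult[of "4 * (p / ln p)" "1 / 2" p] by simp
  have "(\<Sum>j\<in>?J. proj_energy n p h (insert j S))
      = average (cube n) (\<lambda>\<epsilon>. \<Sum>j\<in>?J. (norm (?x \<epsilon> + ?c j \<epsilon>) powr p + norm (?x \<epsilon> - ?c j \<epsilon>) powr p) / 2)"
    unfolding average_sum proj_energy_def
    by (intro sum.cong refl average_norm_cube_proj_insert) auto
  also have "\<dots> \<le> average (cube n) (\<lambda>\<epsilon>. real (card ?J) * norm (?x \<epsilon>) powr p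
      + p powr (5 / 2) * (norm (?x \<epsilon>) powr (p - 2) * cube_proj n S (\<lambda>\<eta>. (norm (h \<eta>))\<^sup>2) \<epsilon>)
      + (2 * (p / ln p)) powr p * (\<Sum>j\<in>?J. cube_proj n S (?D j) \<epsilon>))"
  proof (intro average_mono)
    fix \<epsilon> assume \<epsilon>: "\<epsilon> \<in> cube n"
    have "(\<Sum>j\<in>?J. (norm (?x \<epsilon> + ?c j \<epsilon>) powr p + norm (?x \<epsilon> - ?c j \<epsilon>) powr p) / 2)
        \<le> (\<Sum>j\<in>?J. norm (?x \<epsilon>) powr p + p powr (5 / 2) * norm (?x \<epsilon>) powr (p - 2) * (norm (?c j \<epsilon>))\<^sup>2
             + (4 * (p / ln p)) powr p * norm (?c j \<epsilon>) powr p)"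
      using p by (intro sum_mono symmetrized_norm_powr_le)
    also have "\<dots> \<le> (\<Sum>j\<in>?J. norm (?x \<epsilon>) powr p + p powr (5 / 2) * norm (?x \<epsilon>) powr (p - 2) * (norm (?c j \<epsilon>))\<^sup>2
             + (4 * (p / ln p)) powr p * ((1 / 2) powr p * cube_proj n S (?D j) \<epsilon>))"
      using p by (intro sum_mono add_left_mono mult_left_mono norm_increment_powr_le[OF \<epsilon>]) auto
    also have "\<dots> = real (card ?J) * norm (?x \<epsilon>) powr p
      + p powr (5 / 2) * norm (?x \<epsilon>) powr (p - 2) * (\<Sum>j\<in>?J. (norm (?c j \<epsilon>))\<^sup>2)
      + (2 * (p / ln p)) powr p * (\<Sum>j\<in>?J. cube_proj n S (?D j) \<epsilon>)"
      unfolding half by (simp add: sum.distrib sum_distrib_left)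
    also have "\<dots> \<le> real (card ?J) * norm (?x \<epsilon>) powr p
      + p powr (5 / 2) * norm (?x \<epsilon>) powr (p - 2) * cube_proj n S (\<lambda>\<eta>. (norm (h \<eta>))\<^sup>2) \<epsilon>
      + (2 * (p / ln p)) powr p * (\<Sum>j\<in>?J. cube_proj n S (?D j) \<epsilon>)"
      by (intro add_left_mono add_right_mono mult_left_mono sum_norm_increment_square_le \<epsilon>) auto
    finally show "(\<Sum>j\<in>?J. (norm (?x \<epsilon> + ?c j \<epsilon>) powr p + norm (?x \<epsilon> - ?c j \<epsilon>) powr p) / 2)
        \<le> real (card ?J) * norm (?x \<epsilon>) powr p
      + p powr (5 / 2) * (norm (?x \<epsilon>) powr (p - 2) * cube_proj n S (\<lambda>\<eta>. (norm (h \<eta>))\<^sup>2) \<epsilon>)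
      + (2 * (p / ln p)) powr p * (\<Sum>j\<in>?J. cube_proj n S (?D j) \<epsilon>)" by (simp add: mult.assoc)
  qed
  also have "\<dots> = real (card ?J) * proj_energy n p h S
      + p powr (5 / 2) * average (cube n) (\<lambda>\<epsilon>. norm (?x \<epsilon>) powr (p - 2) * cube_proj n S (\<lambda>\<eta>. (norm (h \<eta>))\<^sup>2) \<epsilon>)
      + (2 * (p / ln p)) powr p * (\<Sum>j\<in>?J. average (cube n) (cube_proj n S (?D j)))"
    by (simp only: average_add average_cmult average_sum proj_energy_def)
  also have "average (cube n) (\<lambda>\<epsilon>. norm (?x \<epsilon>) powr (p - 2) * cube_proj n S (\<lambda>\<eta>. (norm (h \<eta>))\<^sup>2) \<epsilon>)
      = average (cube n) (\<lambda>\<epsilon>. norm (?x \<epsilon>) powr (p - 2) * (norm (h \<epsilon>))\<^sup>2)"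
    by (intro average_mult_cube_proj) (metis cube_proj_fiber)
  finally show ?thesis unfolding average_cube_proj .
qed

section \<open>Uniformly random sets of coordinates\<close>

definition subset_average :: "nat \<Rightarrow> nat \<Rightarrow> (nat set \<Rightarrow> real) \<Rightarrow> real" where
  "subset_average n i F = (\<Sum>S | S \<subseteq> {1..n} \<and> card S = i. F S) / real (n choose i)"

lemma finite_subsets [simp]: "finite {S. S \<subseteq> {1..n::nat} \<and> card S = i}"
  by (rule finite_subset[of _ "Pow {1..n}"]) auto

lemma sum_subsets_eq: "i \<le> n \<Longrightarrow>
  (\<Sum>S | S \<subseteq> {1..n} \<and> card S = i. F S) = real (n choose i) * subset_average n i F"
  by (simp add: subset_average_def)

text \<open>
  A set of size \<open>Suc i\<close> with a marked element is a set of size \<open>i\<close> with an element to be added.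
\<close>

lemma sum_subsets_insert:
  fixes F :: "nat set \<Rightarrow> real"
  shows "(\<Sum>S | S \<subseteq> {1..n} \<and> card S = i. \<Sum>j\<in>{1..n} - S. F (insert j S))
    = real (Suc i) * (\<Sum>T | T \<subseteq> {1..n} \<and> card T = Suc i. F T)"
proof -
  have fin: "finite S" if "S \<subseteq> {1..n}" for S using that finite_subset by blast
  have "(\<Sum>S | S \<subseteq> {1..n} \<and> card S = i. \<Sum>j\<in>{1..n} - S. F (insert j S))
      = (\<Sum>(S, j)\<in>Sigma {S. S \<subseteq> {1..n} \<and> card S = i} (\<lambda>S. {1..n} - S). F (insert j S))"
    by (rule sum.Sigma) auto
  also have "\<dots> = (\<Sum>(T, j)\<in>Sigma {T. T \<subseteq> {1..n} \<and> card T = Suc i} (\<lambda>T. T). F T)"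
    by (intro sum.reindex_bij_witness[of _ "\<lambda>(T, j). (T - {j}, j)" "\<lambda>(S, j). (insert j S, j)"])
       (auto simp: fin card_insert_if insert_absorb card_Diff_singleton)
  also have "\<dots> = (\<Sum>T | T \<subseteq> {1..n} \<and> card T = Suc i. \<Sum>j\<in>T. F T)"
    by (rule sum.Sigma[symmetric]) (auto simp: fin)
  also have "\<dots> = real (Suc i) * (\<Sum>T | T \<subseteq> {1..n} \<and> card T = Suc i. F T)"
    unfolding sum_distrib_left by (intro sum.cong refl) simp
  finally show ?thesis .
qed

lemma sum_subsets_sum_complement:
  fixes v :: "nat \<Rightarrow> real"
  assumes i: "i < n"
  shows "(\<Sum>S | S \<subseteq> {1..n} \<and> card S = i. \<Sum>j\<in>{1..n} - S. v j)
    = real (n choose i) * real (n - i) * ((\<Sum>j=1..n. v j) / real n)"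
proof -
  have "(\<Sum>S | S \<subseteq> {1..n} \<and> card S = i. \<Sum>j\<in>{1..n} - S. v j)
      = (\<Sum>S | S \<subseteq> {1..n} \<and> card S = i. \<Sum>j | j \<in> {1..n} \<and> j \<notin> S. v j)"
    by (intro sum.cong refl) auto
  also have "\<dots> = (\<Sum>j\<in>{1..n}. \<Sum>S | S \<in> {S. S \<subseteq> {1..n} \<and> card S = i} \<and> j \<notin> S. v j)"
    by (rule sum.swap_restrict) auto
  also have "\<dots> = (\<Sum>j=1..n. real ((n - 1) choose i) * v j)"
  proof (intro sum.cong refl)
    fix j assume j: "j \<in> {1..n}"
    have "{S \<in> {S. S \<subseteq> {1..n} \<and> card S = i}. j \<notin> S} = {S. S \<subseteq> {1..n} - {j} \<and> card S = i}"
      by auto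
    then have "card {S \<in> {S. S \<subseteq> {1..n} \<and> card S = i}. j \<notin> S} = (n - 1) choose i"
      using j by (simp add: n_subsets)
    then show "(\<Sum>S | S \<in> {S. S \<subseteq> {1..n} \<and> card S = i} \<and> j \<notin> S. v j) = real ((n - 1) choose i) * v j"
      by simp
  qed
  also have "\<dots> = real n * real ((n - 1) choose i) * ((\<Sum>j=1..n. v j) / real n)"
    using i by (simp flip: sum_distrib_left)
  also have "real n * real ((n - 1) choose i) = real (n choose i) * real (n - i)"
    using binomial_absorb_comp[of n i] by (metis of_nat_mult mult.commute)
  finally show ?thesis .
qed

lemma subset_average_Suc:
  assumes i: "i < n"
  shows "real (n choose i) * real (n - i) * subset_average n (Suc i) F
    = (\<Sum>S | S \<subseteq> {1..n} \<and> card S = i. \<Sum>j\<in>{1..n} - S. F (insert j S))"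
proof -
  have "Suc i * (n choose Suc i) = (n choose i) * (n - i)"
    using binomial_absorption[of i "n"] binomial_absorb_comp[of n i] by (simp add: mult.commute)
  then have "real (n choose i) * real (n - i) = real (Suc i) * real (n choose Suc i)"
    by (metis of_nat_mult)
  then show ?thesis
    unfolding sum_subsets_insert sum_subsets_eq[OF Suc_leI[OF i]] by simp
qed

lemma subset_average_le_const:
  assumes i: "i \<le> n" and le: "\<And>S. S \<subseteq> {1..n} \<Longrightarrow> card S = i \<Longrightarrow> F S \<le> c"
  shows "subset_average n i F \<le> c"
proof -
  have "(\<Sum>S | S \<subseteq> {1..n} \<and> card S = i. F S) \<le> (\<Sum>S | S \<subseteq> {1..n} \<and> card S = i. c)"
    using le by (intro sum_mono) auto
  then have "real (n choose i) * subset_average n i F \<le> real (n choose i) * c"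
    unfolding sum_subsets_eq[OF i, of F] by (simp add: n_subsets)
  then show ?thesis using i by (simp add: mult_le_cancel_left)
qed

section \<open>The recursion over the size of the set\<close>

text \<open>
  Hoelder's inequality for the joint average over sets and points, with the bound for the
  projections relaxed by a factor \<open>\<theta>\<close>. Only one power of \<open>\<theta>\<close> is lost, which is the form in which the
  recursion consumes it.
\<close>

lemma subset_average_mixed_le:
  fixes h :: "(nat \<Rightarrow> real) \<Rightarrow> 'a::real_normed_vector"
  assumes p: "p \<ge> 2" and i: "i \<le> n" and W: "W > 0" and Y: "Y > 0" and \<theta>: "\<theta> \<ge> 1"
    and hW: "subset_average n i (proj_energy n p h) \<le> \<theta> * W powr p"
    and hY: "average (cube n) (\<lambda>\<epsilon>. norm (h \<epsilon>) powr p) \<le> Y powr p"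
  shows "subset_average n i (\<lambda>S. average (cube n)
      (\<lambda>\<epsilon>. norm (cube_proj n S h \<epsilon>) powr (p - 2) * (norm (h \<epsilon>))\<^sup>2)) \<le> \<theta> * W powr (p - 2) * Y\<^sup>2"
proof -
  let ?q = "\<lambda>S. average (cube n) (\<lambda>\<epsilon>. norm (cube_proj n S h \<epsilon>) powr (p - 2) * (norm (h \<epsilon>))\<^sup>2)"
  let ?A = "W powr (p - 2) * Y\<^sup>2" and ?a = "(p - 2) / p / W powr p" and ?b = "2 / p / Y powr p"
  have q: "?q S \<le> ?A * ?a * proj_energy n p h S + ?A * (2 / p)" for S
  proof -
    have "?q S \<le> average (cube n) (\<lambda>\<epsilon>. ?A * ?a * norm (cube_proj n S h \<epsilon>) powr p
        + ?A * ?b * norm (h \<epsilon>) powr p)"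
    proof (intro average_mono)
      fix \<epsilon>
      show "norm (cube_proj n S h \<epsilon>) powr (p - 2) * (norm (h \<epsilon>))\<^sup>2
          \<le> ?A * ?a * norm (cube_proj n S h \<epsilon>) powr p + ?A * ?b * norm (h \<epsilon>) powr p"
        using powr_mult_square_le[OF norm_ge_zero norm_ge_zero W Y p, of "cube_proj n S h \<epsilon>" "h \<epsilon>"]
        by (simp add: algebra_simps)
    qed
    also have "\<dots> = ?A * ?a * proj_energy n p h S + ?A * ?b * average (cube n) (\<lambda>\<epsilon>. norm (h \<epsilon>) powr p)"
      by (simp only: average_add average_cmult proj_energy_def)
    also have "\<dots> \<le> ?A * ?a * proj_energy n p h S + ?A * ?b * Y powr p"
      using p by (intro add_left_mono mult_left_mono hY) auto
    also have "?A * ?b * Y powr p = ?A * (2 / p)" using Y by simp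
    finally show ?thesis .
  qed
  have "(\<Sum>S | S \<subseteq> {1..n} \<and> card S = i. ?q S)
      \<le> (\<Sum>S | S \<subseteq> {1..n} \<and> card S = i. ?A * ?a * proj_energy n p h S + ?A * (2 / p))"
    by (intro sum_mono q)
  also have "\<dots> = ?A * ?a * (\<Sum>S | S \<subseteq> {1..n} \<and> card S = i. proj_energy n p h S) + real (n choose i) * (?A * (2 / p))"
    unfolding sum.distrib sum_distrib_left[symmetric] by (simp add: n_subsets)
  finally have "real (n choose i) * subset_average n i ?q
      \<le> real (n choose i) * (?A * ?a * subset_average n i (proj_energy n p h) + ?A * (2 / p))"
    unfolding sum_subsets_eq[OF i] by (simp add: algebra_simps)
  then have "subset_average n i ?q \<le> ?A * ?a * subset_average n i (proj_energy n p h) + ?A * (2 / p)"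
    using i by (simp add: mult_le_cancel_left)
  also have "\<dots> \<le> ?A * ?a * (\<theta> * W powr p) + ?A * (\<theta> * (2 / p))"
  proof (intro add_mono mult_left_mono hW)
    show "0 \<le> ?A * ?a" using p by simp
    show "2 / p \<le> \<theta> * (2 / p)" using p mult_right_mono[OF \<theta>, of "2 / p"] by simp
  qed auto
  also have "\<dots> = ?A * \<theta> * ((p - 2) / p + 2 / p)"
    using W by (simp add: distrib_left mult_ac)
  also have "(p - 2) / p + 2 / p = 1" using p by (simp add: field_simps)
  finally show ?thesis by (simp add: mult_ac)
qed

lemma subset_average_proj_energy_Suc_le:
  fixes h :: "(nat \<Rightarrow> real) \<Rightarrow> 'a::real_inner"
  assumes p: "p \<ge> 2" and i: "i < n"
  shows "subset_average n (Suc i) (proj_energy n p h)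
    \<le> subset_average n i (proj_energy n p h)
      + p powr (5 / 2) / real (n - i) * subset_average n i (\<lambda>S. average (cube n)
          (\<lambda>\<epsilon>. norm (cube_proj n S h \<epsilon>) powr (p - 2) * (norm (h \<epsilon>))\<^sup>2))
      + (2 * (p / ln p)) powr p
        * ((\<Sum>j=1..n. average (cube n) (\<lambda>\<epsilon>. norm (cube_deriv j h \<epsilon>) powr p)) / real n)"
proof -
  let ?U = "proj_energy n p h" and ?N = "real (n choose i)" and ?m = "real (n - i)"
  let ?q = "\<lambda>S. average (cube n) (\<lambda>\<epsilon>. norm (cube_proj n S h \<epsilon>) powr (p - 2) * (norm (h \<epsilon>))\<^sup>2)"
  let ?v = "\<lambda>j. average (cube n) (\<lambda>\<epsilon>. norm (cube_deriv j h \<epsilon>) powr p)"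
  let ?V = "(\<Sum>j=1..n. ?v j) / real n" and ?B = "(2 * (p / ln p)) powr p" and ?G = "p powr (5 / 2)"
  have pos: "?N > 0" "?m > 0" using i by auto
  have factor: "m * (N * a) + G * (N * b) + B * (N * m * V) = N * m * (a + G / m * b + B * V)"
    if "m > 0" for m N a b G B V :: real
    using that by (simp add: field_simps)
  have "?N * ?m * subset_average n (Suc i) ?U
      \<le> (\<Sum>S | S \<subseteq> {1..n} \<and> card S = i. ?m * ?U S + ?G * ?q S + ?B * (\<Sum>j\<in>{1..n} - S. ?v j))"
    unfolding subset_average_Suc[OF i]
  proof (intro sum_mono)
    fix S assume "S \<in> {S. S \<subseteq> {1..n} \<and> card S = i}"
    then have "card ({1..n} - S) = n - i" by (auto simp: card_Diff_subset finite_subset)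
    then show "(\<Sum>j\<in>{1..n} - S. ?U (insert j S)) \<le> ?m * ?U S + ?G * ?q S + ?B * (\<Sum>j\<in>{1..n} - S. ?v j)"
      using sum_proj_energy_insert_le[OF p, of n h S] by simp
  qed
  also have "\<dots> = ?m * (?N * subset_average n i ?U) + ?G * (?N * subset_average n i ?q) + ?B * (?N * ?m * ?V)"
    unfolding sum.distrib sum_distrib_left[symmetric] sum_subsets_sum_complement[OF i]
      sum_subsets_eq[OF less_imp_le[OF i]] ..
  also have "\<dots> = ?N * ?m * (subset_average n i ?U + ?G / ?m * subset_average n i ?q + ?B * ?V)"
    using factor[OF pos(2)] .
  finally show ?thesis using pos by (simp add: mult_le_cancel_left)
qed

text \<open>
  Writing \<open>u\<close> for the averaged energy, the recursion reads
  \<open>u (Suc i) \<le> u i + p / 2 * g * u i powr (1 - 2 / p) + T / k\<close>. Without the last term it is the Euler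
  scheme of a differential equation solved by powers \<open>p / 2\<close> of affine functions of slope \<open>g\<close>, and the
  tangent inequality says that such a power is a supersolution. The factor \<open>1 + i / k\<close> absorbs the \<open>k\<close>
  summands \<open>T / k\<close>. Bounding every \<open>u i\<close> on the right by the largest one instead would lose a factor of
  order \<open>sqrt p\<close> in the constant in front of the norm of \<open>h\<close>. The affine function uses \<open>Suc i\<close>
  in order to be positive at \<open>0\<close>, where the tangent is taken in the first step.
\<close>

lemma subset_average_proj_energy_le:
  fixes h :: "(nat \<Rightarrow> real) \<Rightarrow> 'a::real_inner"
  assumes p: "p \<ge> 2" and k: "1 \<le> k" "2 * k \<le> n" and mean: "cube_expectation n h = 0"
    and Y: "Y > 0" "average (cube n) (\<lambda>\<epsilon>. norm (h \<epsilon>) powr p) \<le> Y powr p"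
  defines "T \<equiv> (2 * (p / ln p)) powr p
      * (real k / real n * (\<Sum>j=1..n. average (cube n) (\<lambda>\<epsilon>. norm (cube_deriv j h \<epsilon>) powr p)))"
    and "g \<equiv> 4 * p powr (3 / 2) * Y\<^sup>2 / real n"
  assumes i: "i \<le> k"
  shows "subset_average n i (proj_energy n p h)
    \<le> (1 + real i / real k) * (T powr (2 / p) + real (Suc i) * g) powr (p / 2)"
  using i
proof (induction i)
  case 0
  have "{S. S \<subseteq> {1..n} \<and> card S = 0} = {{}}"
    by (auto simp: finite_subset)
  moreover have "cube_proj n {} h \<epsilon> = 0" for \<epsilon>
    using mean by (simp add: cube_proj_def cube_expectation_def)
  ultimately have "subset_average n 0 (proj_energy n p h) = 0"
    by (simp add: subset_average_def proj_energy_def average_def)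
  then show ?case by simp
next
  case (Suc i)
  let ?u = "\<lambda>i. subset_average n i (proj_energy n p h)"
  define w where "w = (\<lambda>i. T powr (2 / p) + real (Suc i) * g)"
  define \<theta> where "\<theta> = 1 + real i / real k"
  have n: "real n > 0" using k by simp
  have g: "g > 0" using p Y n by (simp add: g_def)
  have w: "w i > 0" "w (Suc i) = w i + g"
    using g by (auto simp: w_def algebra_simps intro!: add_nonneg_pos add_pos_nonneg)
  have T: "T \<ge> 0" unfolding T_def by (intro mult_nonneg_nonneg sum_nonneg average_nonneg) auto
  have \<theta>: "\<theta> \<ge> 1" by (simp add: \<theta>_def)
  have in': "i < n" using Suc.prems k by simp
  \<comment> \<open>Hoelder's inequality is used with \<open>sqrt (w i)\<close> as the bound for the \<open>p\<close>-norm of the projections.\<close>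
  have IH: "?u i \<le> \<theta> * sqrt (w i) powr p"
    using Suc w by (simp add: \<theta>_def w_def powr_half_sqrt[symmetric] powr_powr)
  have mixed: "subset_average n i (\<lambda>S. average (cube n)
      (\<lambda>\<epsilon>. norm (cube_proj n S h \<epsilon>) powr (p - 2) * (norm (h \<epsilon>))\<^sup>2))
      \<le> \<theta> * sqrt (w i) powr (p - 2) * Y\<^sup>2" (is "?q \<le> _")
    using subset_average_mixed_le[OF p _ _ Y(1) \<theta> IH Y(2)] w in' by simp
  have "p powr (5 / 2) / real (n - i) * ?q \<le> p powr (5 / 2) * (2 / real n) * (\<theta> * sqrt (w i) powr (p - 2) * Y\<^sup>2)"
  proof (intro mult_mono mixed)
    \<comment> \<open>Here at least half of the coordinates are still unrevealed.\<close>
    show "p powr (5 / 2) / real (n - i) \<le> p powr (5 / 2) * (2 / real n)"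
      using Suc.prems k p by (simp add: field_simps of_nat_diff)
    show "0 \<le> ?q" unfolding subset_average_def
      by (intro divide_nonneg_nonneg sum_nonneg average_nonneg) auto
  qed auto
  also have "\<dots> = \<theta> * (p / 2 * w i powr (p / 2 - 1) * g)"
  proof -
    have "sqrt (w i) powr (p - 2) = w i powr (p / 2 - 1)"
      using w by (simp add: powr_half_sqrt[symmetric] powr_powr diff_divide_distrib)
    moreover have "p powr (5 / 2) = p * p powr (3 / 2)"
      using p powr_add[of p 1 "3 / 2"] by simp
    ultimately show ?thesis by (simp add: g_def)
  qed
  finally have drift: "p powr (5 / 2) / real (n - i) * ?q \<le> \<theta> * (p / 2 * w i powr (p / 2 - 1) * g)" .
  have noise: "(2 * (p / ln p)) powr p
      * ((\<Sum>j=1..n. average (cube n) (\<lambda>\<epsilon>. norm (cube_deriv j h \<epsilon>) powr p)) / real n) = T / real k"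
    using k by (simp add: T_def)
  have "T = (T powr (2 / p)) powr (p / 2)" using T p by (simp add: powr_powr)
  also have "\<dots> \<le> w (Suc i) powr (p / 2)"
    using g p by (intro powr_mono2) (auto simp: w_def)
  finally have T_le: "T \<le> w (Suc i) powr (p / 2)" .
  have bern: "w i powr (p / 2) + p / 2 * w i powr (p / 2 - 1) * g \<le> w (Suc i) powr (p / 2)"
    using powr_above_tangent[of "w (Suc i)" "w i" "p / 2"] w g p by simp
  have "?u (Suc i) \<le> ?u i + p powr (5 / 2) / real (n - i) * ?q + T / real k"
    using subset_average_proj_energy_Suc_le[OF p in', of h] unfolding noise .
  also have "\<dots> \<le> \<theta> * w i powr (p / 2) + \<theta> * (p / 2 * w i powr (p / 2 - 1) * g) + w (Suc i) powr (p / 2) / real k"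
    using Suc T_le drift by (intro add_mono divide_right_mono) (auto simp: \<theta>_def w_def)
  also have "\<dots> = \<theta> * (w i powr (p / 2) + p / 2 * w i powr (p / 2 - 1) * g) + w (Suc i) powr (p / 2) / real k"
    by (simp add: algebra_simps)
  also have "\<dots> \<le> \<theta> * w (Suc i) powr (p / 2) + w (Suc i) powr (p / 2) / real k"
    using \<theta> bern by (intro add_right_mono mult_left_mono) auto
  also have "\<dots> = (1 + real (Suc i) / real k) * w (Suc i) powr (p / 2)"
    by (simp add: \<theta>_def add_divide_distrib algebra_simps)
  finally show ?case unfolding w_def .
qed

section \<open>The inequality\<close>

lemma cube_Lp_norm_powr:
  "p > 0 \<Longrightarrow> cube_Lp_norm n p h powr p = average (cube n) (\<lambda>\<epsilon>. norm (h \<epsilon>) powr p)"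
  by (simp add: cube_Lp_norm_def cube_expectation_def powr_powr average_nonneg)

lemma proj_moment_eq:
  "p > 0 \<Longrightarrow> proj_moment n k p h = subset_average n k (proj_energy n p h) powr (1 / p)"
  by (simp add: proj_moment_def subset_average_def proj_energy_def cube_Lp_norm_powr)

lemma subset_average_proj_energy_nonneg: "0 \<le> subset_average n k (proj_energy n p h)"
  unfolding subset_average_def proj_energy_def
  by (intro divide_nonneg_nonneg sum_nonneg average_nonneg) auto

text \<open>
  The projections are contractions.
\<close>

lemma proj_moment_le_Lp_norm:
  assumes "p \<ge> 1" "k \<le> n"
  shows "proj_moment n k p h \<le> cube_Lp_norm n p h"
proof -
  have "subset_average n k (proj_energy n p h) \<le> cube_Lp_norm n p h powr p"
    using assms
    by (intro subset_average_le_const) (auto simp: proj_energy_def cube_Lp_norm_powr average_norm_cube_proj_powr_le)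
  then have "proj_moment n k p h \<le> (cube_Lp_norm n p h powr p) powr (1 / p)"
    using assms subset_average_proj_energy_nonneg
    by (subst proj_moment_eq) (auto intro!: powr_mono2)
  also have "\<dots> = cube_Lp_norm n p h" using assms by (simp add: powr_powr cube_Lp_norm_def cube_expectation_def average_nonneg)
  finally show ?thesis .
qed

text \<open>
  If more than half of the coordinates are revealed, contractivity suffices because \<open>k / n\<close> is bounded
  below. Otherwise the solved recursion bounds the projections by the derivatives with constant of
  order \<open>p / ln p\<close>, and by \<open>h\<close> with constant of order \<open>p powr (3 / 4)\<close>, which is smaller.
\<close>

theorem proj_moment_le_deriv_moment:
  fixes h :: "(nat \<Rightarrow> real) \<Rightarrow> 'a::real_inner"
  assumes p: "p \<ge> 2" and k: "k \<in> {1..n}" and mean: "cube_expectation n h = 0"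
  shows "proj_moment n k p h \<le> 24 * (p / ln p) * deriv_moment n k p h"
proof -
  define R where "R = p / ln p"
  define Y where "Y = cube_Lp_norm n p h"
  define Z where "Z = deriv_moment n k p h"
  define X where "X = real k / real n * (\<Sum>j=1..n. average (cube n) (\<lambda>\<epsilon>. norm (cube_deriv j h \<epsilon>) powr p))"
  have ln: "ln p > 0" "ln p \<le> p" using p ln_bound[of p] by auto
  have R: "R \<ge> 1" using ln by (simp add: R_def)
  have nonneg: "Y \<ge> 0" "Z \<ge> 0" by (auto simp: Y_def Z_def cube_Lp_norm_def deriv_moment_def)
  have X: "X \<ge> 0" unfolding X_def by (intro mult_nonneg_nonneg sum_nonneg average_nonneg) auto
  have kn: "0 < real k / real n" "real k / real n \<le> 1" using k by auto
  have Zp: "Z powr p = X + (real k / real n) powr (p / 2) * Y powr p"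
  proof -
    have "Z = (X + (real k / real n) powr (p / 2) * Y powr p) powr (1 / p)"
      using p by (simp add: Z_def deriv_moment_def X_def Y_def cube_Lp_norm_powr)
    then show ?thesis using X p by (simp add: powr_powr)
  qed
  have root: "(Z powr p) powr (2 / p) = Z\<^sup>2"
    using p nonneg by (cases "Z = 0") (simp_all add: powr_powr powr_numeral)
  have XZ: "X powr (2 / p) \<le> Z\<^sup>2"
    unfolding root[symmetric] using p X Zp by (intro powr_mono2) auto
  have YZ: "real k / real n * Y\<^sup>2 \<le> Z\<^sup>2"
  proof -
    have "real k / real n * Y\<^sup>2 = ((real k / real n) powr (p / 2) * Y powr p) powr (2 / p)"
      using kn p nonneg by (cases "Y = 0") (simp_all add: powr_mult powr_powr powr_numeral)
    also have "\<dots> \<le> Z\<^sup>2"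
      unfolding root[symmetric] using p X Zp by (intro powr_mono2) auto
    finally show ?thesis .
  qed
  have "proj_moment n k p h \<le> 24 * R * Z"
  proof (cases "2 * k \<le> n \<and> Y > 0")
    case False
    have "Y \<le> 2 * Z"
    proof (cases "Y = 0")
      case True then show ?thesis using nonneg by simp
    next
      case Y: False
      then have "real k / real n \<ge> 1 / 2" using False k nonneg by (simp add: field_simps)
      then have "1 / 2 * Y\<^sup>2 \<le> real k / real n * Y\<^sup>2" by (intro mult_right_mono) auto
      then have "1 / 2 * Y\<^sup>2 \<le> Z\<^sup>2" using YZ by (rule order_trans)
      moreover have "0 \<le> Z\<^sup>2" by simp
      ultimately have "Y\<^sup>2 \<le> 4 * Z\<^sup>2" by linarith
      then have "Y\<^sup>2 \<le> (2 * Z)\<^sup>2" by (simp add: power_mult_distrib)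
      then show ?thesis by (rule power2_le_imp_le) (use nonneg in simp)
    qed
    moreover have "2 * Z \<le> 24 * R * Z" using R nonneg by (intro mult_right_mono) auto
    moreover have "proj_moment n k p h \<le> Y"
      unfolding Y_def using p k by (intro proj_moment_le_Lp_norm) auto
    ultimately show ?thesis by linarith
  next
    case True
    define g where "g = 4 * p powr (3 / 2) * Y\<^sup>2 / real n"
    let ?u = "subset_average n k (proj_energy n p h)"
    let ?w = "((2 * R) powr p * X) powr (2 / p) + real (Suc k) * g"
    have k': "1 \<le> k" "2 * k \<le> n" using True k by auto
    have Yp: "average (cube n) (\<lambda>\<epsilon>. norm (h \<epsilon>) powr p) \<le> Y powr p"
      using p by (simp add: Y_def cube_Lp_norm_powr)
    have u: "?u \<le> 2 * ?w powr (p / 2)"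
      using subset_average_proj_energy_le[OF p k' mean conjunct2[OF True] Yp order.refl] k'
      by (simp add: X_def g_def R_def)
    have g: "g \<ge> 0" by (simp add: g_def)
    have "((2 * R) powr p * X) powr (2 / p) = (2 * R)\<^sup>2 * X powr (2 / p)"
      using p R by (simp add: powr_mult powr_powr powr_numeral)
    also have "\<dots> \<le> (2 * R)\<^sup>2 * Z\<^sup>2" by (intro mult_left_mono XZ) auto
    finally have w1: "((2 * R) powr p * X) powr (2 / p) \<le> 4 * (R\<^sup>2 * Z\<^sup>2)" by (simp add: power_mult_distrib)
    \<comment> \<open>This is \<open>ln p \<le> 4 * p powr (1 / 4)\<close>.\<close>
    have "p powr (3 / 4) \<le> 4 * R"
    proof -
      have "p powr (3 / 4) * ln p \<le> p powr (3 / 4) * (4 * p powr (1 / 4))"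
        using ln_powr_bound[of p "1 / 4"] p by (intro mult_left_mono) auto
      also have "\<dots> = 4 * p" using p by (simp flip: powr_add)
      finally show ?thesis using ln by (simp add: R_def field_simps)
    qed
    then have "(p powr (3 / 4))\<^sup>2 \<le> (4 * R)\<^sup>2" by (intro power_mono) auto
    moreover have "(p powr (3 / 4))\<^sup>2 = p powr (3 / 2)"
      by (simp add: power2_eq_square flip: powr_add)
    ultimately have p32: "p powr (3 / 2) \<le> 16 * R\<^sup>2" by (simp add: power_mult_distrib)
    have "real (Suc k) * g \<le> (2 * real k) * g" using k' g by (intro mult_right_mono) auto
    also have "\<dots> = 8 * (p powr (3 / 2) * (real k / real n * Y\<^sup>2))" by (simp add: g_def)
    also have "\<dots> \<le> 8 * ((16 * R\<^sup>2) * Z\<^sup>2)"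
      using p32 YZ kn by (intro mult_left_mono mult_mono) auto
    finally have w2: "real (Suc k) * g \<le> 128 * (R\<^sup>2 * Z\<^sup>2)" by simp
    have "?w \<le> 132 * (R\<^sup>2 * Z\<^sup>2)" using w1 w2 by linarith
    also have "\<dots> \<le> 144 * (R\<^sup>2 * Z\<^sup>2)" by (intro mult_right_mono) auto
    also have "\<dots> = (12 * R * Z)\<^sup>2" by (simp add: power_mult_distrib)
    finally have "?w powr (p / 2) \<le> ((12 * R * Z)\<^sup>2) powr (p / 2)"
      using p g by (intro powr_mono2) auto
    also have "\<dots> = (12 * R * Z) powr p"
      using p R nonneg powr_powr[of "12 * R * Z" 2 "p / 2"] by (simp add: powr_numeral)
    finally have "?u \<le> 2 * (12 * R * Z) powr p" using u by linarith
    also have "\<dots> \<le> 2 powr p * (12 * R * Z) powr p"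
      using powr_mono[of 1 p 2] p by (intro mult_right_mono) auto
    also have "\<dots> = (24 * R * Z) powr p" by (simp add: mult.assoc flip: powr_mult)
    finally have "?u powr (1 / p) \<le> ((24 * R * Z) powr p) powr (1 / p)"
      using p subset_average_proj_energy_nonneg by (intro powr_mono2) auto
    also have "\<dots> = 24 * R * Z" using p R nonneg by (simp add: powr_powr)
    finally show ?thesis using p by (simp add: proj_moment_eq)
  qed
  then show ?thesis by (simp only: R_def Z_def)
qed

section \<open>Sharpness\<close>

lemma card_fiber:
  assumes "\<epsilon> \<in> cube n" "S \<subseteq> {1..n}"
  shows "card (fiber n S \<epsilon>) = 2 ^ (n - card S)"
proof -
  have "fiber n S \<epsilon> = (\<Pi>\<^sub>E j\<in>{1..n}. if j \<in> S then {\<epsilon> j} else {-1, 1})"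
  proof (intro set_eqI iffI)
    fix \<eta> assume "\<eta> \<in> fiber n S \<epsilon>"
    then show "\<eta> \<in> (\<Pi>\<^sub>E j\<in>{1..n}. if j \<in> S then {\<epsilon> j} else {-1, 1})"
      unfolding fiber_def cube_def PiE_iff by fastforce
  next
    fix \<eta> assume "\<eta> \<in> (\<Pi>\<^sub>E j\<in>{1..n}. if j \<in> S then {\<epsilon> j} else {-1, 1})"
    then have ext: "\<eta> \<in> extensional {1..n}"
      and val: "j \<in> {1..n} \<Longrightarrow> \<eta> j \<in> (if j \<in> S then {\<epsilon> j} else {-1, 1})" for j
      unfolding PiE_iff by blast+
    have "\<eta> j \<in> {-1, 1}" if "j \<in> {1..n}" for j
      using val[OF that] cube_cases[OF assms(1) that] by (auto split: if_splits)
    moreover have "\<eta> j = \<epsilon> j" if "j \<in> S" for j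
      using val[of j] that assms(2) by auto
    ultimately show "\<eta> \<in> fiber n S \<epsilon>"
      using ext unfolding fiber_def cube_def PiE_iff by blast
  qed
  then have "card (fiber n S \<epsilon>) = (\<Prod>j\<in>{1..n}. if j \<in> S then 1 else 2)"
    by (simp add: card_PiE if_distrib[of card] numeral_2_eq_2 cong: if_cong)
  also have "\<dots> = 2 ^ card ({1..n} - S)"
    by (simp add: prod.If_cases Diff_eq)
  also have "card ({1..n} - S) = n - card S"
    using assms finite_subset[OF assms(2)] by (simp add: card_Diff_subset)
  finally show ?thesis .
qed

lemma card_cube: "card (cube n) = 2 ^ n"
proof -
  obtain \<epsilon> where "\<epsilon> \<in> cube n" using cube_nonempty by blast
  then show ?thesis using card_fiber[of \<epsilon> n "{}"] by (simp add: fiber_def)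
qed

text \<open>
  Nearly extremal when \<open>m\<close> is about \<open>p / ln p\<close>.
\<close>

definition coordinate_sum :: "nat \<Rightarrow> (nat \<Rightarrow> real) \<Rightarrow> real" where
  "coordinate_sum m \<epsilon> = (\<Sum>j=1..m. \<epsilon> j)"

lemma cube_expectation_coordinate_sum:
  assumes "m \<le> n"
  shows "cube_expectation n (coordinate_sum m) = 0"
proof -
  have "average (cube n) (\<lambda>\<epsilon>. \<epsilon> j) = 0" if "j \<in> {1..m}" for j
    using sum_fiber_coordinate[of j n "{}"] that assms by (simp add: average_def fiber_def)
  then have "(\<Sum>j=1..m. average (cube n) (\<lambda>\<epsilon>. \<epsilon> j)) = 0" by simp
  then show ?thesis by (simp add: cube_expectation_def coordinate_sum_def[abs_def] average_sum)
qed

text \<open>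
  Only the event that the first \<open>m\<close> coordinates are all equal to \<open>1\<close> is taken into account.
\<close>

lemma average_coordinate_sum_powr_ge:
  assumes "m \<le> n"
  shows "real m powr p / 2 ^ m \<le> average (cube n) (\<lambda>\<epsilon>. norm (coordinate_sum m \<epsilon>) powr p)"
proof -
  define \<epsilon> where "\<epsilon> = (\<lambda>j. if j \<in> {1..n} then 1 else undefined :: real)"
  have \<epsilon>: "\<epsilon> \<in> cube n" by (auto simp: \<epsilon>_def cube_def PiE_iff extensional_def)
  let ?F = "fiber n {1..m} \<epsilon>"
  have val: "coordinate_sum m \<eta> = real m" if "\<eta> \<in> ?F" for \<eta>
  proof -
    have "coordinate_sum m \<eta> = (\<Sum>j=1..m. 1)"
      unfolding coordinate_sum_def using that assms
      by (intro sum.cong refl) (auto simp: fiber_def \<epsilon>_def)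
    then show ?thesis by simp
  qed
  have "real (card ?F) * real m powr p = (\<Sum>\<eta>\<in>?F. norm (coordinate_sum m \<eta>) powr p)"
    by (simp add: val)
  also have "\<dots> \<le> (\<Sum>\<eta>\<in>cube n. norm (coordinate_sum m \<eta>) powr p)"
    by (intro sum_mono2 finite_cube) (auto simp: fiber_def)
  finally have "2 ^ (n - m) * real m powr p \<le> (\<Sum>\<eta>\<in>cube n. norm (coordinate_sum m \<eta>) powr p)"
    using card_fiber[OF \<epsilon>, of "{1..m}"] assms by simp
  then have "2 ^ (n - m) * real m powr p / 2 ^ n \<le> average (cube n) (\<lambda>\<epsilon>. norm (coordinate_sum m \<epsilon>) powr p)"
    by (simp add: average_def card_cube field_simps)
  moreover have "2 ^ n = (2::real) ^ (n - m) * 2 ^ m" using assms by (simp flip: power_add)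
  ultimately show ?thesis by simp
qed

lemma cube_proj_coordinate_sum:
  assumes "\<epsilon> \<in> cube n"
  shows "cube_proj n {1..m} (coordinate_sum m) \<epsilon> = coordinate_sum m \<epsilon>"
proof -
  have "average (fiber n {1..m} \<epsilon>) (coordinate_sum m) = average (fiber n {1..m} \<epsilon>) (\<lambda>_. coordinate_sum m \<epsilon>)"
    by (intro average_cong) (auto simp: fiber_def coordinate_sum_def intro!: sum.cong)
  then show ?thesis
    using self_mem_fiber[OF assms] by (subst (asm) average_const) (auto simp: cube_proj_eq_average_fiber)
qed

text \<open>
  Only the set \<open>{1..m}\<close> is taken into account. Its weight is at least \<open>m powr (- 3 * m)\<close>, which costs a
  bounded factor after taking the \<open>p\<close>-th root when \<open>m\<close> is of order \<open>p / ln p\<close>.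
\<close>

lemma proj_moment_coordinate_sum_ge:
  assumes m: "1 \<le> m" and p: "p \<ge> 2"
  shows "real m * (2 * real m ^ 3) powr (- real m / p) \<le> proj_moment (m ^ 3) m p (coordinate_sum m)"
proof -
  let ?n = "m ^ 3" and ?h = "coordinate_sum m"
  have mn: "m \<le> ?n" using m by (simp add: self_le_power)
  have "real m powr p / (2 * real m ^ 3) ^ m = real m powr p / 2 ^ m / real (?n ^ m)"
    by (simp add: power_mult_distrib)
  also have "\<dots> \<le> average (cube ?n) (\<lambda>\<epsilon>. norm (?h \<epsilon>) powr p) / real (?n choose m)"
  proof (intro frac_le average_coordinate_sum_powr_ge[OF mn])
    show "real (?n choose m) \<le> real (?n ^ m)" using binomial_le_pow[OF mn] of_nat_mono by blast
  qed (use mn in \<open>auto intro: average_nonneg\<close>)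
  also have "average (cube ?n) (\<lambda>\<epsilon>. norm (?h \<epsilon>) powr p) = proj_energy ?n p ?h {1..m}"
    unfolding proj_energy_def by (intro average_cong) (simp only: cube_proj_coordinate_sum)
  also have "\<dots> / real (?n choose m) \<le> subset_average ?n m (proj_energy ?n p ?h)"
    unfolding subset_average_def using mn
    by (intro divide_right_mono member_le_sum) (auto simp: proj_energy_def intro!: average_nonneg)
  finally have le: "real m powr p / (2 * real m ^ 3) ^ m \<le> subset_average ?n m (proj_energy ?n p ?h)" .
  have "real m * (2 * real m ^ 3) powr (- real m / p) = (real m powr p / (2 * real m ^ 3) ^ m) powr (1 / p)"
  proof -
    have "(2 * real m ^ 3) ^ m = (2 * real m ^ 3) powr real m"
      using m by (intro powr_realpow[symmetric]) simp
    then have "((2 * real m ^ 3) ^ m) powr (1 / p) = (2 * real m ^ 3) powr (real m / p)"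
      by (simp only: powr_powr times_divide_eq_right mult_1_right)
    then show ?thesis
      using m p by (simp only: powr_divide powr_powr) (simp add: powr_minus_divide)
  qed
  also have "\<dots> \<le> subset_average ?n m (proj_energy ?n p ?h) powr (1 / p)"
    using p by (intro powr_mono2 le) auto
  finally show ?thesis using p by (simp add: proj_moment_eq)
qed

text \<open>
  The choice \<open>k = m\<close>, \<open>n = m ^ 3\<close> makes \<open>k / n = 1 / m\<^sup>2\<close>: the second term of the moment is at most \<open>1\<close> by
  the trivial bound \<open>m\<close> for the sum, and the \<open>m\<close> nonzero derivatives, each of norm \<open>2\<close>, contribute only
  \<open>2 powr p / m\<close>.
\<close>

lemma deriv_moment_coordinate_sum_le:
  assumes m: "2 \<le> m" and p: "p \<ge> 2"
  shows "deriv_moment (m ^ 3) m p (coordinate_sum m) \<le> 2"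
proof -
  let ?n = "m ^ 3" and ?h = "coordinate_sum m"
  have mn: "m \<le> ?n" using m by (simp add: self_le_power)
  have ratio: "real m / real ?n = 1 / real m ^ 2" using m by (simp add: power2_eq_square power3_eq_cube)
  have deriv: "cube_deriv j ?h \<epsilon> = (if j \<in> {1..m} then 2 * \<epsilon> j else 0)" for j \<epsilon>
  proof -
    have "cube_deriv j ?h \<epsilon> = (\<Sum>i=1..m. if i = j then 2 * \<epsilon> i else 0)"
      unfolding cube_deriv_def coordinate_sum_def sum_subtractf[symmetric]
      by (intro sum.cong refl) auto
    then show ?thesis by simp
  qed
  have V: "cube_Lp_norm ?n p (cube_deriv j ?h) powr p = (if j \<in> {1..m} then 2 powr p else 0)"
    if "j \<in> {1..?n}" for j
  proof -
    have "cube_Lp_norm ?n p (cube_deriv j ?h) powr p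
        = average (cube ?n) (\<lambda>\<epsilon>. if j \<in> {1..m} then 2 powr p else 0)"
      unfolding cube_Lp_norm_powr[OF order.strict_trans2[OF zero_less_numeral p]]
    proof (intro average_cong)
      fix \<epsilon> assume "\<epsilon> \<in> cube ?n"
      then show "norm (cube_deriv j ?h \<epsilon>) powr p = (if j \<in> {1..m} then 2 powr p else 0)"
        using cube_cases[OF _ that] by (fastforce simp: deriv)
    qed
    then show ?thesis by (simp add: average_const finite_cube cube_nonempty)
  qed
  have "(\<Sum>j=1..?n. cube_Lp_norm ?n p (cube_deriv j ?h) powr p)
      = (\<Sum>j=1..?n. if j \<in> {1..m} then 2 powr p else 0)"
    by (intro sum.cong refl V)
  also have "\<dots> = (\<Sum>j\<in>{1..?n} \<inter> {1..m}. 2 powr p)"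
    by (rule sum.inter_restrict[symmetric]) simp
  also have "{1..?n} \<inter> {1..m} = {1..m}" using mn by auto
  finally have D: "(\<Sum>j=1..?n. cube_Lp_norm ?n p (cube_deriv j ?h) powr p) = real m * 2 powr p" by simp
  have "cube_Lp_norm ?n p ?h powr p \<le> average (cube ?n) (\<lambda>\<epsilon>. real m powr p)"
    unfolding cube_Lp_norm_powr[OF order.strict_trans2[OF zero_less_numeral p]]
  proof (intro average_mono powr_mono2)
    fix \<epsilon> assume \<epsilon>: "\<epsilon> \<in> cube ?n"
    have "norm (?h \<epsilon>) \<le> (\<Sum>j=1..m. norm (\<epsilon> j))" unfolding coordinate_sum_def by (rule norm_sum)
    also have "\<dots> \<le> (\<Sum>j=1..m. 1)"
    proof (intro sum_mono)
      fix j assume "j \<in> {1..m}"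
      then show "norm (\<epsilon> j) \<le> 1" using cube_cases[OF \<epsilon>, of j] mn by auto
    qed
    finally show "norm (?h \<epsilon>) \<le> real m" by simp
  qed (use p in auto)
  then have H: "cube_Lp_norm ?n p ?h powr p \<le> real m powr p"
    by (simp add: average_const finite_cube cube_nonempty)
  have "(1 / real m ^ 2) powr (p / 2) * cube_Lp_norm ?n p ?h powr p \<le> (1 / real m ^ 2) powr (p / 2) * real m powr p"
    by (intro mult_left_mono H) auto
  also have "\<dots> = 1"
    using m p powr_powr[of "real m" 2 "p / 2"] by (simp add: powr_divide powr_numeral)
  finally have second: "(1 / real m ^ 2) powr (p / 2) * cube_Lp_norm ?n p ?h powr p \<le> 1" .
  have first: "1 / real m ^ 2 * (real m * 2 powr p) \<le> 2 powr p / 2"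
    using m by (simp add: power2_eq_square field_simps)
  have "(1::real) \<le> 2 powr p / 2"
    using powr_mono[of 1 p 2] p by simp
  with first second have "1 / real m ^ 2 * (real m * 2 powr p)
      + (1 / real m ^ 2) powr (p / 2) * cube_Lp_norm ?n p ?h powr p \<le> 2 powr p" by linarith
  then have "deriv_moment ?n m p ?h \<le> (2 powr p) powr (1 / p)"
    unfolding deriv_moment_def ratio D using p by (intro powr_mono2) auto
  then show ?thesis using p by (simp add: powr_powr)
qed

text \<open>
  For \<open>m\<close> the integer part of \<open>p / ln p\<close>, the factor \<open>(2 * m ^ 3) powr (m / p)\<close> that is lost in the lower bound
  for the projections is at most \<open>exp 7\<close>, because \<open>m / p \<le> 1 / ln p\<close> and \<open>2 * m ^ 3 \<le> p ^ 7\<close>.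
\<close>

lemma proj_moment_constant_ge:
  fixes p K :: real
  assumes p: "p \<ge> 2" and K: "K \<ge> 0"
    and ineq: "\<And>n k. k \<in> {1..n} \<Longrightarrow> \<forall>h :: (nat \<Rightarrow> real) \<Rightarrow> real. cube_expectation n h = 0 \<longrightarrow>
      proj_moment n k p h \<le> K * deriv_moment n k p h"
  shows "exp (-7) / 4 * (p / ln p) \<le> K"
proof -
  define R where "R = p / ln p"
  define m where "m = nat \<lfloor>R\<rfloor>"
  have ln: "ln p > 0" "ln 2 \<le> ln p" using p by auto
  have ln2: "1 / 2 \<le> ln (2 :: real)" "ln (2 :: real) \<le> 1"
    using ln_le_minus_one[of "1 / 2 :: real"] ln_le_minus_one[of "2 :: real"] by (auto simp: ln_div)
  have "ln p \<le> p / 2"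
    using ln_le_minus_one[of "p / 2"] ln2 p by (simp add: ln_div)
  then have R2: "R \<ge> 2" using ln by (simp add: R_def field_simps)
  have m: "m \<ge> 2" "real m \<le> R" "R \<le> 2 * real m"
    using R2 unfolding m_def by linarith+
  have mn: "m \<in> {1..m ^ 3}" using m by (simp add: self_le_power)
  have "real m * (2 * real m ^ 3) powr (- real m / p) \<le> K * deriv_moment (m ^ 3) m p (coordinate_sum m)"
    using proj_moment_coordinate_sum_ge[of m p] m p ineq[OF mn] mn
      cube_expectation_coordinate_sum[of m "m ^ 3"] by fastforce
  also have "\<dots> \<le> K * 2"
    using deriv_moment_coordinate_sum_le[OF m(1) p] K by (intro mult_left_mono) auto
  finally have le: "real m * (2 * real m ^ 3) powr (- real m / p) \<le> K * 2" .
  have "1 / 2 \<le> ln p" using ln2(1) ln(2) by (rule order_trans)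
  then have "R \<le> p / (1 / 2)" unfolding R_def using p by (intro divide_left_mono) auto
  also have "\<dots> \<le> p\<^sup>2" using p by (simp add: power2_eq_square)
  finally have "R \<le> p\<^sup>2" .
  then have "ln (real m) \<le> ln (p\<^sup>2)" using m by (intro ln_mono) auto
  then have "ln (real m) \<le> 2 * ln p" using p by (simp add: ln_realpow)
  then have "ln (2 * real m ^ 3) \<le> 7 * ln p"
    using m ln by (simp add: ln_mult ln_realpow)
  moreover have "real m / p \<le> 1 / ln p" using m ln p by (simp add: R_def field_simps)
  moreover have "ln (2 * real m ^ 3) \<ge> 0" using m by (simp add: ln_mult ln_realpow)
  ultimately have "real m / p * ln (2 * real m ^ 3) \<le> 1 / ln p * (7 * ln p)"
    using ln p by (intro mult_mono) auto
  then have "exp (-7) \<le> (2 * real m ^ 3) powr (- real m / p)"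
    using m ln by (simp add: powr_def)
  then have "real m * exp (-7) \<le> K * 2"
    using le by (meson mult_left_mono of_nat_0_le_iff order_trans)
  moreover have "R * exp (-7) \<le> (2 * real m) * exp (-7)" by (intro mult_right_mono m) auto
  ultimately have "R * exp (-7) \<le> 4 * K" by linarith
  then have "exp (-7) / 4 * R \<le> K" by (simp add: mult.commute)
  then show ?thesis by (simp only: R_def)
qed

theorem theorem1p1:
  shows "(\<exists>C::real. C > 0 \<and>
      (\<forall>p::real. p \<ge> 2 \<longrightarrow> (\<forall>n::nat. \<forall>k\<in>{1..n}.
         (\<forall>h :: (nat \<Rightarrow> real) \<Rightarrow> real. cube_expectation n h = 0 \<longrightarrow>
            proj_moment n k p h \<le> C * (p / ln p) * deriv_moment n k p h) \<and>
         (\<forall>h :: (nat \<Rightarrow> real) \<Rightarrow> complex. cube_expectation n h = 0 \<longrightarrow>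
            proj_moment n k p h \<le> C * (p / ln p) * deriv_moment n k p h)))) \<and>
    (\<exists>c::real. c > 0 \<and>
      (\<forall>p::real. p \<ge> 2 \<longrightarrow> (\<forall>K::real. K \<ge> 0 \<longrightarrow>
         (\<forall>n::nat. \<forall>k\<in>{1..n}.
            (\<forall>h :: (nat \<Rightarrow> real) \<Rightarrow> real. cube_expectation n h = 0 \<longrightarrow>
               proj_moment n k p h \<le> K * deriv_moment n k p h) \<and>
            (\<forall>h :: (nat \<Rightarrow> real) \<Rightarrow> complex. cube_expectation n h = 0 \<longrightarrow>
               proj_moment n k p h \<le> K * deriv_moment n k p h)) \<longrightarrow>
         K \<ge> c * (p / ln p))))"
proof (rule conjI, goal_cases)
  case 1
  show ?case
    by (intro exI[of _ 24] conjI allI ballI impI proj_moment_le_deriv_moment) auto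
next
  case 2
  show ?case
    by (intro exI[of _ "exp (-7) / 4"] conjI allI impI proj_moment_constant_ge) auto
qed

end
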